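(* Suppose $n$ is divisible by a positive integer $k$, and let the subsystem $A$ consist of what remains after tracing out every $k$-th qudit. Let $\rho_A'$ be the normalized density matrix, reduced on $A$, of a random matrix product state drawn from $\mu_{d,n,D}$. Then $$\mathrm{Pr}\left(S_2(\rho_A')\geq \Omega\left(\frac{n}{k}\right)\right)\geq 1-e^{-\Omega(n/k)}.$$
   Context: Random matrix product state (RMPS) of local dimension $d$, system size $n$ and bond dimension $D$: draw $U^{(1)},\dots,U^{(n)}$ independently from the Haar measure on the unitary group $U(dD)$ acting on $\mathbb{C}^d\otimes\mathbb{C}^D$. Fix an orthonormal basis $|0\rangle,\dots,|d-1\rangle$ of $\mathbb{C}^d$ and define the $D\times D$ matrices $A^{(j)}_i:=(\langle i|\otimes \mathbb{1}_D)\,U^{(j)}\,(|0\rangle\otimes \mathbb{1}_D)$ for $0\le i\le d-1$. The RMPS is the (in general unnormalized) vector $$|\psi\rangle=\sum_{i_1,\dots,i_n=0}^{d-1}\mathrm{Tr}\left[A^{(1)}_{i_1}A^{(2)}_{i_2}\cdots A^{(n)}_{i_n}\right]|i_1,\dots,i_n\rangle\in(\mathbb{C}^d)^{\otimes n}$$ (periodic boundary conditions). Its distribution is denoted $\mu_{d,n,D}$. The qudits are the $n$ tensor factors $\mathbb{C}^d$, arranged in a chain and labelled $1,\dots,n$. The normalized density matrix is $|\psi\rangle\langle\psi|/\langle\psi|\psi\rangle$, and $\rho_A'$ is its partial trace over the complement of $A$. The Rényi $2$-entropy of a density matrix $\rho$ is $S_2(\rho)=-\log\mathrm{Tr}[\rho^2]$.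 $\Omega(n/k)$ is the usual asymptotic notation: a quantity bounded below by a positive constant times $n/k$.
   Formalization: The formal statement requires k ≥ 2, d ≥ 2 and D ≥ 2: for k = 1 everything is traced out, for D = 1 the state is a product and for d = 1 it is trivial, so S_2 = 0 and the claim fails for n > 0. The constants in Ω may depend on d and D but not on n, k. *)

theory Defs
  imports "HOL-Probability.Probability"
begin

section \<open>Haar measure on the unitary group\<close>

definition conj_transpose :: "complex^'m^'l \<Rightarrow> complex^'l^'m" where
  "conj_transpose U = (\<chi> i j. cnj (U $ j $ i))"

definition unitary_group :: "(complex^'m^'m) set" where
  "unitary_group = {U. conj_transpose U ** U = mat 1 \<and> U ** conj_transpose U = mat 1}"

text \<open>
  The unitary group is compact, so there is exactly one such measure, and it is also
  invariant under right translations.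
\<close>

definition haar_unitary :: "(complex^'m^'m) measure \<Rightarrow> bool" where
  "haar_unitary \<mu> \<longleftrightarrow>
     prob_space \<mu> \<and>
     sets \<mu> = sets (restrict_space borel unitary_group) \<and>
     (\<forall>V\<in>unitary_group. distr \<mu> \<mu> (\<lambda>W. V ** W) = \<mu>)"


section \<open>Qudits\<close>

text \<open>
  The type \<open>'d\<close> labels the orthonormal basis of a single qudit. A set \<open>S\<close> of qudits has the
  product basis \<open>configs S\<close>; vectors are given by their amplitudes and operators by their matrix
  entries with respect to it. Only values at configurations in \<open>configs S\<close> are meaningful.
\<close>

definition configs :: "nat set \<Rightarrow> (nat \<Rightarrow> 'd) set" where
  "configs S = S \<rightarrow>\<^sub>E UNIV"

definition op_trace :: "nat set \<Rightarrow> ((nat \<Rightarrow> 'd) \<Rightarrow> (nat \<Rightarrow> 'd) \<Rightarrow> complex) \<Rightarrow> complex" where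
  "op_trace S \<rho> = (\<Sum>x\<in>configs S. \<rho> x x)"

definition op_mult ::
    "nat set \<Rightarrow> ((nat \<Rightarrow> 'd) \<Rightarrow> (nat \<Rightarrow> 'd) \<Rightarrow> complex)
      \<Rightarrow> ((nat \<Rightarrow> 'd) \<Rightarrow> (nat \<Rightarrow> 'd) \<Rightarrow> complex) \<Rightarrow> (nat \<Rightarrow> 'd) \<Rightarrow> (nat \<Rightarrow> 'd) \<Rightarrow> complex" where
  "op_mult S \<rho> \<sigma> x y = (\<Sum>z\<in>configs S. \<rho> x z * \<sigma> z y)"

definition norm_square :: "nat set \<Rightarrow> ((nat \<Rightarrow> 'd) \<Rightarrow> complex) \<Rightarrow> complex" where
  "norm_square S \<psi> = (\<Sum>x\<in>configs S. cnj (\<psi> x) * \<psi> x)"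

text \<open>
  For \<open>\<psi> = 0\<close> division by zero makes this the zero operator, whose \<open>renyi2_entropy\<close> below is
  \<open>- ln 0 = 0\<close>.
\<close>

definition density_matrix ::
    "nat set \<Rightarrow> ((nat \<Rightarrow> 'd) \<Rightarrow> complex) \<Rightarrow> (nat \<Rightarrow> 'd) \<Rightarrow> (nat \<Rightarrow> 'd) \<Rightarrow> complex" where
  "density_matrix S \<psi> x y = \<psi> x * cnj (\<psi> y) / norm_square S \<psi>"

text \<open>The reduction to \<open>A\<close> of an operator on \<open>S\<close>, for \<open>A \<subseteq> S\<close>: the qudits in \<open>S - A\<close> are
  traced out.\<close>

definition partial_trace ::
    "nat set \<Rightarrow> nat set \<Rightarrow> ((nat \<Rightarrow> 'd) \<Rightarrow> (nat \<Rightarrow> 'd) \<Rightarrow> complex)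
      \<Rightarrow> (nat \<Rightarrow> 'd) \<Rightarrow> (nat \<Rightarrow> 'd) \<Rightarrow> complex" where
  "partial_trace S A \<rho> x y =
     (\<Sum>z\<in>configs (S - A). \<rho> (merge A (S - A) (x, z)) (merge A (S - A) (y, z)))"

definition renyi2_entropy ::
    "nat set \<Rightarrow> ((nat \<Rightarrow> 'd) \<Rightarrow> (nat \<Rightarrow> 'd) \<Rightarrow> complex) \<Rightarrow> real" where
  "renyi2_entropy S \<rho> = - ln (Re (op_trace S (op_mult S \<rho> \<rho>)))"


section \<open>Random matrix product states\<close>

text \<open>
  \<open>\<complex>\<^sup>d \<otimes> \<complex>\<^sup>D\<close> has the product basis indexed by \<open>'d \<times> 'b\<close>, where \<open>d = CARD('d)\<close> and
  \<open>D = CARD('b)\<close>. The basis label \<open>e0 :: 'd\<close> plays the role of \<open>|0\<rangle>\<close>.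
\<close>

definition mps_matrix :: "'d::finite \<Rightarrow> complex^('d \<times> 'b::finite)^('d \<times> 'b) \<Rightarrow> 'd \<Rightarrow> complex^'b^'b" where
  "mps_matrix e0 U i = (\<chi> a b. U $ (i, a) $ (e0, b))"

definition mps :: "'d::finite \<Rightarrow> nat \<Rightarrow> (nat \<Rightarrow> complex^('d \<times> 'b::finite)^('d \<times> 'b))
    \<Rightarrow> (nat \<Rightarrow> 'd) \<Rightarrow> complex" where
  "mps e0 n U x = trace (foldr (\<lambda>j P. mps_matrix e0 (U j) (x j) ** P) [1..<Suc n] (mat 1))"

text \<open>The distribution \<open>\<mu>\<^bsub>d,n,D\<^esub>\<close> of the random state, when \<open>\<mu>\<close> is the Haar measure on \<open>U(dD)\<close>.\<close>

definition rmps :: "(complex^('d::finite \<times> 'b::finite)^('d \<times> 'b)) measure \<Rightarrow> 'd \<Rightarrow> nat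
    \<Rightarrow> ((nat \<Rightarrow> 'd) \<Rightarrow> complex) measure" where
  "rmps \<mu> e0 n =
     distr (Pi\<^sub>M {1..n} (\<lambda>_. \<mu>)) (Pi\<^sub>M (configs {1..n}) (\<lambda>_. borel))
       (\<lambda>U. restrict (mps e0 n U) (configs {1..n}))"

end

theory Submission
  imports Defs
begin

text \<open>
  Write \<open>N = \<langle>\<psi>|\<psi>\<rangle>\<close> and let \<open>X\<close> be the purity of the unnormalised reduced state, so that the
  entropy is \<open>- ln (X / N\<^sup>2)\<close>. Both \<open>X\<close> and \<open>N\<^sup>2\<close> are traces of a product of one-site tensors, each
  quadratic in \<open>U\<close> and in its conjugate; averaging over the Haar measure leaves only the two ways
  of pairing the virtual indices, and the expectations become traces of products of \<open>2 \<times> 2\<close>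
  matrices, one kind for the sites in \<open>A\<close>, another for the traced out sites.
  The first kind has the eigenvalues \<open>1\<close> and \<open>\<lambda> < 1\<close>, hence \<open>E N\<^sup>2 = 1 + \<lambda>\<^sup>n\<close>, while \<open>E N = 1\<close>. One block
  of \<open>k\<close> sites contracts the positive vector \<open>(1, 1/D)\<close> by a factor \<open>q < 1\<close> independent of \<open>k\<close>, hence
  \<open>E X \<le> 2 q\<^sup>m\<close> with \<open>m = n / k\<close>. For large \<open>m\<close>, Markov's inequality for \<open>X\<close> and Chebyshev's for \<open>N\<close>
  suffice. For bounded \<open>m\<close> the probability only has to be bounded away from \<open>0\<close>, which follows from
  \<open>E N\<^sup>2 - E X = det (1 - B) \<ge> (1 - q)\<^sup>2\<close>, where \<open>B\<close> is the product of all \<open>2 \<times> 2\<close> matrices.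
\<close>

section \<open>Second moments of the Haar measure\<close>

lemma unitary_group_mult:
  assumes "V \<in> unitary_group" "W \<in> unitary_group"
  shows "V ** W \<in> unitary_group"
proof -
  have ct: "conj_transpose (V ** W) = conj_transpose W ** conj_transpose V"
    by (simp add: conj_transpose_def matrix_matrix_mult_def vec_eq_iff mult.commute)
  have "conj_transpose (V ** W) ** (V ** W) = conj_transpose W ** (conj_transpose V ** V) ** W"
    "(V ** W) ** conj_transpose (V ** W) = V ** (W ** conj_transpose W) ** conj_transpose V"
    unfolding ct by (simp_all add: matrix_mul_assoc)
  with assms show ?thesis
    by (simp add: unitary_group_def)
qed

lemma unitary_group_columns:
  assumes "W \<in> unitary_group"
  shows "(\<Sum>p\<in>UNIV. W $ p $ x * cnj (W $ p $ z)) = of_bool (x = z)"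
proof -
  have "(conj_transpose W ** W) $ z $ x = mat 1 $ z $ x"
    using assms by (simp add: unitary_group_def)
  then show ?thesis
    by (auto simp: conj_transpose_def matrix_matrix_mult_def mat_def mult.commute)
qed

lemma unitary_group_entry_le:
  assumes "W \<in> unitary_group"
  shows "norm (W $ p $ x) \<le> 1"
proof -
  have "(norm (W $ p $ x))\<^sup>2 \<le> (\<Sum>p\<in>UNIV. (norm (W $ p $ x))\<^sup>2)"
    by (rule member_le_sum) auto
  also have "complex_of_real \<dots> = 1"
    using unitary_group_columns[OF assms, of x x]
    by (simp add: complex_norm_square del: of_real_power)
  then have "(\<Sum>p\<in>UNIV. (norm (W $ p $ x))\<^sup>2) = 1"
    using of_real_eq_1_iff by blast
  finally show ?thesis
    by (simp add: power_le_one_iff abs_square_le_1)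
qed

section \<open>Integration against the Haar measure\<close>

lemma haar_unitary_space: "haar_unitary \<mu> \<Longrightarrow> space \<mu> = unitary_group"
  unfolding haar_unitary_def using sets_eq_imp_space_eq[of \<mu> "restrict_space borel unitary_group"]
  by (simp add: space_restrict_space)

lemma haar_unitary_measurable_entry:
  assumes "haar_unitary \<mu>"
  shows "(\<lambda>W. W $ p $ x) \<in> borel_measurable \<mu>"
proof -
  have "(\<lambda>W. W $ p $ x) \<in> borel_measurable (restrict_space borel unitary_group)"
    by (intro measurable_restrict_space1 borel_measurable_continuous_onI continuous_intros)
  then show ?thesis
    using assms measurable_cong_sets unfolding haar_unitary_def by blast
qed

lemma haar_unitary_measurable_mult:
  assumes "haar_unitary \<mu>" "V \<in> unitary_group"
  shows "(\<lambda>W. V ** W) \<in> measurable \<mu> \<mu>"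
proof -
  have "continuous_on UNIV (\<lambda>W. V ** W)"
    unfolding matrix_matrix_mult_def
    by (intro continuous_intros continuous_on_vec_lambda)
  then have "(\<lambda>W. V ** W) \<in> measurable borel borel"
    by (rule borel_measurable_continuous_onI)
  then have "(\<lambda>W. V ** W) \<in> measurable (restrict_space borel unitary_group)
      (restrict_space borel unitary_group)"
    using assms by (intro measurable_restrict_space3) (auto simp: unitary_group_mult)
  moreover have "sets \<mu> = sets (restrict_space borel unitary_group)"
    using assms by (simp add: haar_unitary_def)
  ultimately show ?thesis
    using measurable_cong_sets by blast
qed

lemma haar_unitary_integral_mult:
  fixes f :: "complex^'m^'m \<Rightarrow> complex"
  assumes "haar_unitary \<mu>" "V \<in> unitary_group" "f \<in> borel_measurable \<mu>"
  shows "(\<integral>W. f (V ** W) \<partial>\<mu>) = (\<integral>W. f W \<partial>\<mu>)"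
proof -
  have "(\<integral>W. f (V ** W) \<partial>\<mu>) = (\<integral>W. f W \<partial>distr \<mu> \<mu> (\<lambda>W. V ** W))"
    using haar_unitary_measurable_mult[OF assms(1,2)] assms(3) by (rule integral_distr[symmetric])
  then show ?thesis
    using assms(1,2) by (simp add: haar_unitary_def)
qed

lemma haar_unitary_integrable:
  fixes f :: "complex^'m^'m \<Rightarrow> complex"
  assumes "haar_unitary \<mu>" "f \<in> borel_measurable \<mu>"
    and "\<And>W. W \<in> unitary_group \<Longrightarrow> norm (f W) \<le> B"
  shows "integrable \<mu> f"
proof -
  interpret prob_space \<mu> using assms(1) by (simp add: haar_unitary_def)
  show ?thesis
    using assms haar_unitary_space[OF assms(1)] by (intro integrable_const_bound[where B = B]) auto
qed

text \<open>The columns \<open>x y z w\<close> come first, so that for fixed columns the moment is a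
  function of the rows \<open>p q r t\<close>, the indices on which left multiplication acts. Rows
  and columns belong together as \<open>p x\<close>, \<open>q y\<close> for the entries and
  \<open>r z\<close>, \<open>t w\<close> for the conjugates.\<close>

definition haar_moment ::
    "(complex^'m^'m) measure \<Rightarrow> 'm \<Rightarrow> 'm \<Rightarrow> 'm \<Rightarrow> 'm \<Rightarrow> 'm \<Rightarrow> 'm \<Rightarrow> 'm \<Rightarrow> 'm \<Rightarrow> complex" where
  "haar_moment \<mu> x y z w p q r t =
     (\<integral>W. W $ p $ x * W $ q $ y * cnj (W $ r $ z) * cnj (W $ t $ w) \<partial>\<mu>)"

lemma norm_mult_le_one: "norm a \<le> 1 \<Longrightarrow> norm b \<le> 1 \<Longrightarrow> norm (a * b :: complex) \<le> 1"
  by (simp add: norm_mult mult_le_one)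

lemma measurable_cnj: "f \<in> borel_measurable M \<Longrightarrow> (\<lambda>x. cnj (f x)) \<in> borel_measurable M"
  by (rule borel_measurable_continuous_on[OF continuous_on_cnj[OF continuous_on_id]])

lemma haar_moment_integrable:
  assumes "haar_unitary \<mu>"
  shows "integrable \<mu> (\<lambda>W. W $ p $ x * W $ q $ y * cnj (W $ r $ z) * cnj (W $ t $ w))"
  using assms
  by (intro haar_unitary_integrable[where B = 1] borel_measurable_times measurable_cnj
      haar_unitary_measurable_entry norm_mult_le_one)
    (auto simp: unitary_group_entry_le)

text \<open>Left multiplication by the diagonal unitary with entries \<open>\<phi> i\<close> scales
  row \<open>i\<close> by that phase.\<close>

lemma haar_moment_diagonal:
  fixes \<mu> :: "(complex^'m^'m) measure"
  assumes "haar_unitary \<mu>" "\<And>i. norm (\<phi> i) = 1"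
  shows "haar_moment \<mu> x y z w p q r t
    = \<phi> p * \<phi> q * cnj (\<phi> r) * cnj (\<phi> t) * haar_moment \<mu> x y z w p q r t"
proof -
  define V :: "complex^'m^'m" where "V = (\<chi> i j. if i = j then \<phi> i else 0)"
  have ph: "\<phi> i * cnj (\<phi> i) = 1" for i
    using assms(2)[of i] complex_norm_square[of "\<phi> i"] by simp
  have VW: "(V ** W) $ i $ j = \<phi> i * W $ i $ j" for W i j
    by (simp add: V_def matrix_matrix_mult_def if_distrib[of "\<lambda>x. x * _"] cong: if_cong)
  have ct: "conj_transpose V $ i $ j = (if i = j then cnj (\<phi> i) else 0)" for i j
    by (simp add: conj_transpose_def V_def)
  have 1: "V ** conj_transpose V = mat 1"
    unfolding vec_eq_iff VW ct using ph by (simp add: mat_def)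
  then have "conj_transpose V ** V = mat 1"
    by (simp add: matrix_left_right_inverse)
  with 1 have "V \<in> unitary_group"
    by (simp add: unitary_group_def)
  from haar_unitary_integral_mult[OF assms(1) this
      borel_measurable_integrable[OF haar_moment_integrable[OF assms(1), of p x q y r z t w]]]
  have "haar_moment \<mu> x y z w p q r t = (\<integral>W. (\<phi> p * \<phi> q * cnj (\<phi> r) * cnj (\<phi> t)) *
       (W $ p $ x * W $ q $ y * cnj (W $ r $ z) * cnj (W $ t $ w)) \<partial>\<mu>)"
    by (simp add: haar_moment_def VW mult_ac)
  then show ?thesis
    by (simp add: haar_moment_def)
qed

lemma haar_moment_eq_0:
  assumes "haar_unitary \<mu>" and "\<not> (p = r \<and> q = t)" "\<not> (p = t \<and> q = r)"
  shows "haar_moment \<mu> x y z w p q r t = 0"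
proof -
  \<comment> \<open>The phase \<i> on row \<open>s\<close> alone produces \<i> to the number of
    occurrences of \<open>s\<close> among \<open>p, q\<close> minus that among \<open>r, t\<close>.
    The difference has absolute value at most 2, so the power is 1 only if it vanishes; over all
    \<open>s\<close> this forces the two pairs to agree up to order.\<close>
  define e where "e s = (\<lambda>i. if i = s then \<i> else 1)" for s :: 'a
  have e: "haar_moment \<mu> x y z w p q r t
    = e s p * e s q * cnj (e s r) * cnj (e s t) * haar_moment \<mu> x y z w p q r t" for s
    by (rule haar_moment_diagonal[OF assms(1)]) (simp add: e_def)
  then have "haar_moment \<mu> x y z w p q r t = 0
      \<or> e s p * e s q * cnj (e s r) * cnj (e s t) = 1" for s
    by (metis mult_cancel_right1)
  from this[of p] this[of q] this[of r] this[of t] show ?thesis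
    using assms(2,3) unfolding e_def by (auto simp: complex_eq_iff[of _ 1] split: if_splits)
qed

text \<open>For \<open>a = 0, b = 1\<close> the matrix \<open>V\<close> below is a permutation matrix, for
  \<open>a = (1 + \<i>) / 2, b = (1 - \<i>) / 2\<close> it is a square root of that matrix.\<close>

lemma haar_moment_transpose:
  fixes \<mu> :: "(complex^'m^'m) measure"
  assumes "haar_unitary \<mu>" and \<pi>: "\<And>i. \<pi> (\<pi> i) = i"
    and "a * cnj a + b * cnj b = 1" "a * cnj b + b * cnj a = 0"
  shows "haar_moment \<mu> x y z w p q r t = (\<integral>W. (a * W $ p $ x + b * W $ \<pi> p $ x) *
    (a * W $ q $ y + b * W $ \<pi> q $ y) * cnj (a * W $ r $ z + b * W $ \<pi> r $ z)
    * cnj (a * W $ t $ w + b * W $ \<pi> t $ w) \<partial>\<mu>)"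
proof -
  define V :: "complex^'m^'m" where
    "V = (\<chi> i j. a * (if i = j then 1 else 0) + b * (if \<pi> i = j then 1 else 0))"
  have VW: "(V ** W) $ i $ j = a * W $ i $ j + b * W $ \<pi> i $ j" for W i j
    by (simp add: V_def matrix_matrix_mult_def distrib_right sum.distrib mult.assoc
        if_distrib[of "\<lambda>x. x * _"] sum_distrib_left[symmetric] cong: if_cong)
  have \<pi>': "\<pi> i = j \<longleftrightarrow> \<pi> j = i" for i j
    using \<pi> by metis
  have ct: "conj_transpose V $ i $ j
      = cnj a * (if i = j then 1 else 0) + cnj b * (if \<pi> i = j then 1 else 0)" for i j
    unfolding conj_transpose_def V_def using \<pi>'[of i j] by simp
  have "(V ** conj_transpose V) $ i $ j = (a * cnj a + b * cnj b) * (if i = j then 1 else 0)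
      + (a * cnj b + b * cnj a) * (if \<pi> i = j then 1 else 0)" for i j
    unfolding VW ct \<pi> by (simp only: distrib_left distrib_right mult.assoc add_ac)
  then have 1: "V ** conj_transpose V = mat 1"
    unfolding vec_eq_iff assms(3,4) by (simp add: mat_def)
  then have "conj_transpose V ** V = mat 1"
    by (simp add: matrix_left_right_inverse)
  with 1 have "V \<in> unitary_group"
    by (simp add: unitary_group_def)
  from haar_unitary_integral_mult[OF assms(1) this
      borel_measurable_integrable[OF haar_moment_integrable[OF assms(1), of p x q y r z t w]]]
  show ?thesis
    by (simp add: haar_moment_def VW)
qed

lemma haar_moment_permute:
  assumes "haar_unitary \<mu>" "\<And>i. \<pi> (\<pi> i) = i"
  shows "haar_moment \<mu> x y z w (\<pi> p) (\<pi> q) (\<pi> r) (\<pi> t) = haar_moment \<mu> x y z w p q r t"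
  using haar_moment_transpose[OF assms, of 0 1 x y z w p q r t] by (simp add: haar_moment_def)

lemma sum_product_4:
  fixes f g h e :: "'a \<Rightarrow> 'c::comm_semiring_0"
  shows "sum f A * sum g A * sum h A * sum e A
    = (\<Sum>i\<in>A. \<Sum>j\<in>A. \<Sum>k\<in>A. \<Sum>l\<in>A. f i * g j * h k * e l)"
  by (simp only: mult.assoc sum_distrib_right) (simp only: sum_distrib_left)

text \<open>The square root of the transposition of \<open>p\<close> and \<open>q\<close> mixes
  these two rows. Of the 16 terms of the expanded moment only six have matching rows, each with
  weight 1/4; they yield twice each of the three moments in the statement, and the equation is
  solved for the first.\<close>

lemma haar_moment_same:
  assumes "haar_unitary \<mu>" "p \<noteq> q"
  shows "haar_moment \<mu> x y z w p p p p
    = haar_moment \<mu> x y z w p q p q + haar_moment \<mu> x y z w p q q p"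
proof -
  let ?f = "haar_moment \<mu> x y z w"
  let ?t = "Transposition.transpose p q"
  obtain a b :: complex where ab: "cnj a = b" "cnj b = a" "a * b = 1 / 2"
      "a * a + b * b = 0"
    by (rule that[of "(1 + \<i>) / 2" "(1 - \<i>) / 2"]) (simp_all add: complex_eq_iff)
  have sw: "?f q q q q = ?f p p p p" "?f q p q p = ?f p q p q" "?f q p p q = ?f p q q p"
    using haar_moment_permute[OF assms(1), of ?t x y z w p p p p]
      haar_moment_permute[OF assms(1), of ?t x y z w p q p q]
      haar_moment_permute[OF assms(1), of ?t x y z w p q q p] by simp_all
  have z: "?f i j k l = 0" if "\<not> (i = k \<and> j = l)" "\<not> (i = l \<and> j = k)" for i j k l
    using haar_moment_eq_0[OF assms(1) that] .
  have "?f p p p p = (\<integral>W. (a * W $ p $ x + b * W $ q $ x) *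
    (a * W $ p $ y + b * W $ q $ y) * cnj (a * W $ p $ z + b * W $ q $ z)
    * cnj (a * W $ p $ w + b * W $ q $ w) \<partial>\<mu>)"
    using haar_moment_transpose[OF assms(1), of ?t a b x y z w p p p p] ab
    by (simp add: mult.commute)
  also have "\<dots> = (\<integral>W. (\<Sum>i\<in>{p, q}. \<Sum>j\<in>{p, q}. \<Sum>k\<in>{p, q}. \<Sum>l\<in>{p, q}.
     ((if i = p then a else b) * (if j = p then a else b) * (if k = p then b else a) *
     (if l = p then b else a)) * (W $ i $ x * W $ j $ y * cnj (W $ k $ z) * cnj (W $ l $ w))) \<partial>\<mu>)"
  proof (rule Bochner_Integration.integral_cong[OF refl])
    fix W :: "complex^'a^'a"
    let ?g = "\<lambda>c d x i. (if i = p then c else d) * W $ i $ x"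
    have 1: "a * W $ p $ x + b * W $ q $ x = (\<Sum>i\<in>{p, q}. ?g a b x i)" for x
      using assms(2) by simp
    have 2: "cnj (a * W $ p $ x + b * W $ q $ x)
        = (\<Sum>i\<in>{p, q}. (if i = p then b else a) * cnj (W $ i $ x))" for x
      using assms(2) by (simp add: ab)
    show "(a * W $ p $ x + b * W $ q $ x) * (a * W $ p $ y + b * W $ q $ y) *
        cnj (a * W $ p $ z + b * W $ q $ z) * cnj (a * W $ p $ w + b * W $ q $ w) =
      (\<Sum>i\<in>{p, q}. \<Sum>j\<in>{p, q}. \<Sum>k\<in>{p, q}. \<Sum>l\<in>{p, q}.
        ((if i = p then a else b) * (if j = p then a else b) * (if k = p then b else a) *
        (if l = p then b else a)) * (W $ i $ x * W $ j $ y * cnj (W $ k $ z) * cnj (W $ l $ w)))"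
      unfolding 2 unfolding 1 sum_product_4 by (intro sum.cong refl) simp
  qed
  also have "\<dots> = (\<Sum>i\<in>{p, q}. \<Sum>j\<in>{p, q}. \<Sum>k\<in>{p, q}. \<Sum>l\<in>{p, q}.
     ((if i = p then a else b) * (if j = p then a else b) * (if k = p then b else a) *
     (if l = p then b else a)) * ?f i j k l)"
    unfolding haar_moment_def by (simp only: Bochner_Integration.integral_sum
        Bochner_Integration.integrable_sum integrable_mult_right haar_moment_integrable[OF assms(1)]
        Bochner_Integration.integral_mult_right simp_thms)
  also have "\<dots> = (a * b) * (a * b) * (2 * ?f p p p p + 2 * ?f p q p q + 2 * ?f p q q p)"
    using assms(2) by (simp add: z sw algebra_simps)
  also have "\<dots> = (2 * ?f p p p p + 2 * ?f p q p q + 2 * ?f p q q p) / 4"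
    unfolding ab by simp
  finally have "2 * ?f p p p p = 2 * (?f p q p q + ?f p q q p)"
    by (simp add: field_simps)
  then show ?thesis
    unfolding mult_cancel_left by simp
qed

text \<open>Transpositions carry every ordered pair of distinct elements to every other one: one
  coordinate is replaced at a time, and the pair is reversed first if the new first element is the
  old second one.\<close>

lemma two_transitive_invariant:
  fixes g :: "'m \<Rightarrow> 'm \<Rightarrow> 'c"
  assumes "\<And>i j p q. g (Transposition.transpose i j p) (Transposition.transpose i j q) = g p q"
    and "p \<noteq> q" "p' \<noteq> q'"
  shows "g p q = g p' q'"
proof -
  have 1: "g i j = g i' j" if "i \<noteq> j" "i' \<noteq> j" for i i' j
    using assms(1)[of i i' i j] that by simp
  have 2: "g i j = g i j'" if "i \<noteq> j" "i \<noteq> j'" for i j j'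
    using assms(1)[of j j' i j] that by simp
  have 3: "g i j = g j i" for i j
    using assms(1)[of i j i j] by simp
  show ?thesis
  proof (cases "p' = q")
    case True
    then show ?thesis
      using 3[of p q] 2[of q p q'] assms(2,3) by simp
  next
    case False
    then show ?thesis
      using 1[of p q p'] 2[of p' q q'] assms(2,3) by simp
  qed
qed

text \<open>Phases confine the moment to the two pairings of rows, and permutations make it constant
  on each. Where all rows coincide both indicators are 1, and \<open>haar_moment_same\<close> makes
  the form fit there as well.\<close>

lemma haar_moment_form:
  fixes \<mu> :: "(complex^'m^'m) measure"
  assumes \<mu>: "haar_unitary \<mu>" and "CARD('m) \<ge> 2"
  obtains \<alpha> \<beta> where "\<And>p q r t. haar_moment \<mu> x y z w p q r t =
    \<alpha> * (of_bool (p = r) * of_bool (q = t)) + \<beta> * (of_bool (p = t) * of_bool (q = r))"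
proof -
  let ?f = "haar_moment \<mu> x y z w"
  have "\<not> card (UNIV :: 'm set) \<le> Suc 0"
    using assms(2) by simp
  then obtain p0 q0 :: 'm where p0: "p0 \<noteq> q0"
    unfolding card_le_Suc0_iff_eq[OF finite] by blast
  define \<alpha> \<beta> where "\<alpha> = ?f p0 q0 p0 q0" and "\<beta> = ?f p0 q0 q0 p0"
  have a: "?f p q p q = \<alpha>" if "p \<noteq> q" for p q
    unfolding \<alpha>_def
    by (rule two_transitive_invariant[where g = "\<lambda>p q. ?f p q p q", OF _ that p0])
      (rule haar_moment_permute[OF \<mu> transpose_involutory])
  have b: "?f p q q p = \<beta>" if "p \<noteq> q" for p q
    unfolding \<beta>_def
    by (rule two_transitive_invariant[where g = "\<lambda>p q. ?f p q q p", OF _ that p0])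
      (rule haar_moment_permute[OF \<mu> transpose_involutory])
  have c: "?f p p p p = \<alpha> + \<beta>" for p
  proof -
    obtain q where "p \<noteq> q" using p0 by (cases "p = p0") blast+
    then show ?thesis using haar_moment_same[OF \<mu>, of p q] a[of p q] b[of p q] by simp
  qed
  show ?thesis
  proof (rule that[of \<alpha> \<beta>])
    show "?f p q r t = \<alpha> * (of_bool (p = r) * of_bool (q = t)) + \<beta> * (of_bool (p = t) * of_bool (q = r))" for p q r t
    proof -
      have 1: "?f p q p q = \<alpha> + \<beta> * (of_bool (p = q) * of_bool (q = p))"
      proof (cases "p = q")
        case True
        show ?thesis unfolding True c by simp
      qed (simp add: a)
      have 2: "?f p q q p = \<alpha> * (of_bool (p = q) * of_bool (q = p)) + \<beta>"
      proof (cases "p = q")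
        case True
        show ?thesis unfolding True c by simp
      qed (simp add: b)
      show ?thesis
      proof (cases "p = r \<and> q = t")
        case True
        then have rt: "r = p" "t = q" by simp_all
        show ?thesis unfolding rt 1 by simp
      next
        case 3: False
        show ?thesis
        proof (cases "p = t \<and> q = r")
          case True
          then have rt: "t = p" "r = q" by simp_all
          show ?thesis unfolding rt 2 by simp
        next
          case False
          from haar_moment_eq_0[OF \<mu> 3 this] 3 False show ?thesis by auto
        qed
      qed
    qed
  qed
qed

text \<open>This is the Weingarten formula of degree two. Summing the rows along either pairing,
  with the columns orthonormal, gives two linear equations for the coefficients, of determinant
  \<open>N\<^sup>2 * (N\<^sup>2 - 1)\<close>.\<close>

lemma haar_moment_eq:
  fixes \<mu> :: "(complex^'m^'m) measure"
  assumes \<mu>: "haar_unitary \<mu>" and card: "CARD('m) \<ge> 2"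
  defines "N \<equiv> of_nat CARD('m) :: complex"
  shows "haar_moment \<mu> x y z w p q r t =
     ((of_bool (x = z) * of_bool (y = w)) - (of_bool (x = w) * of_bool (y = z)) / N) / (N\<^sup>2 - 1) * (of_bool (p = r) * of_bool (q = t))
   + ((of_bool (x = w) * of_bool (y = z)) - (of_bool (x = z) * of_bool (y = w)) / N) / (N\<^sup>2 - 1) * (of_bool (p = t) * of_bool (q = r))"
proof -
  interpret prob_space \<mu> using \<mu> by (simp add: haar_unitary_def)
  obtain \<alpha> \<beta> where ab: "\<And>p q r t. haar_moment \<mu> x y z w p q r t =
    \<alpha> * (of_bool (p = r) * of_bool (q = t)) + \<beta> * (of_bool (p = t) * of_bool (q = r))"
    using haar_moment_form[OF \<mu> card, of x y z w] by blast
  have "N\<^sup>2 \<noteq> 1"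
    unfolding N_def of_nat_power[symmetric] of_nat_eq_1_iff using card by simp
  then have N: "N \<noteq> 0" "N\<^sup>2 - 1 \<noteq> 0"
    by (simp add: N_def, simp only: right_minus_eq not_False_eq_True)
  have s1: "(\<Sum>p::'m\<in>UNIV. \<Sum>q::'m\<in>UNIV. of_bool (p = p) * of_bool (q = q)) = N\<^sup>2"
    by (simp add: N_def power2_eq_square)
  have s2: "(\<Sum>p::'m\<in>UNIV. \<Sum>q::'m\<in>UNIV. (of_bool (p = q) * of_bool (q = p))) = N"
  proof -
    have "of_bool (p = q) * of_bool (q = p) = (if p = q then 1 else 0 :: complex)" for p q :: 'm
      by auto
    then show ?thesis
      by (simp add: N_def)
  qed
  have "(\<Sum>p\<in>UNIV. \<Sum>q\<in>UNIV. haar_moment \<mu> x y z w p q p q)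
    = (\<integral>W. (\<Sum>p\<in>UNIV. \<Sum>q\<in>UNIV.
        W $ p $ x * W $ q $ y * cnj (W $ p $ z) * cnj (W $ q $ w)) \<partial>\<mu>)"
    unfolding haar_moment_def by (simp only: Bochner_Integration.integral_sum
        Bochner_Integration.integrable_sum haar_moment_integrable[OF \<mu>] simp_thms)
  also have "\<dots> = (\<integral>W. (\<Sum>p\<in>UNIV. W $ p $ x * cnj (W $ p $ z)) *
      (\<Sum>q\<in>UNIV. W $ q $ y * cnj (W $ q $ w)) \<partial>\<mu>)"
    unfolding sum_product by (intro Bochner_Integration.integral_cong sum.cong refl) simp
  also have "\<dots> = (\<integral>W. (of_bool (x = z) * of_bool (y = w)) \<partial>\<mu>)"
    by (intro Bochner_Integration.integral_cong refl)
      (auto simp: unitary_group_columns haar_unitary_space[OF \<mu>])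
  finally have 1: "N\<^sup>2 * \<alpha> + N * \<beta> = (of_bool (x = z) * of_bool (y = w))"
    unfolding ab sum.distrib sum_distrib_left[symmetric] s1 s2 prob_space
    by (simp add: N_def power2_eq_square prob_space algebra_simps)
  have "(\<Sum>p\<in>UNIV. \<Sum>q\<in>UNIV. haar_moment \<mu> x y z w p q q p)
    = (\<integral>W. (\<Sum>p\<in>UNIV. \<Sum>q\<in>UNIV.
        W $ p $ x * W $ q $ y * cnj (W $ q $ z) * cnj (W $ p $ w)) \<partial>\<mu>)"
    unfolding haar_moment_def by (simp only: Bochner_Integration.integral_sum
        Bochner_Integration.integrable_sum haar_moment_integrable[OF \<mu>] simp_thms)
  also have "\<dots> = (\<integral>W. (\<Sum>p\<in>UNIV. W $ p $ x * cnj (W $ p $ w)) *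
      (\<Sum>q\<in>UNIV. W $ q $ y * cnj (W $ q $ z)) \<partial>\<mu>)"
    unfolding sum_product by (intro Bochner_Integration.integral_cong sum.cong refl) simp
  also have "\<dots> = (\<integral>W. (of_bool (x = w) * of_bool (y = z)) \<partial>\<mu>)"
    by (intro Bochner_Integration.integral_cong refl)
      (auto simp: unitary_group_columns haar_unitary_space[OF \<mu>])
  finally have 2: "N * \<alpha> + N\<^sup>2 * \<beta> = (of_bool (x = w) * of_bool (y = z))"
    unfolding ab sum.distrib sum_distrib_left[symmetric] s1 s2 prob_space
    by (simp add: N_def power2_eq_square prob_space algebra_simps)
  \<comment> \<open>Exchanging the unknowns exchanges the right-hand sides, so a single elimination
    gives both coefficients.\<close>
  have solve: "a = (s - t / N) / (N\<^sup>2 - 1)" if "N\<^sup>2 * a + N * b = s" "N * a + N\<^sup>2 * b = t" for a b s t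
  proof -
    have "s - t / N = a * (N\<^sup>2 - 1)"
      unfolding that[symmetric] using N(1) by (simp add: field_simps power2_eq_square)
    then show ?thesis
      using N(2) by simp
  qed
  show ?thesis
    unfolding ab solve[OF 1 2] solve[of \<beta> \<alpha>, OF 2[unfolded add.commute[of "N * \<alpha>"]]
      1[unfolded add.commute[of "N\<^sup>2 * \<alpha>"]]] ..
qed

section \<open>Purity as a product of one-site tensors\<close>

definition matprod :: "('i \<Rightarrow> 'a::semiring_1^'n^'n) \<Rightarrow> 'i list \<Rightarrow> 'a^'n^'n" where
  "matprod f js = foldr (\<lambda>j P. f j ** P) js (mat 1)"

lemma matprod_simps [simp]:
  "matprod f [] = mat 1" "matprod f (j # js) = f j ** matprod f js"
  by (simp_all add: matprod_def)

lemma matprod_append: "matprod f (xs @ ys) = matprod f xs ** matprod f ys"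
  by (induction xs) (simp_all add: matrix_mul_assoc)

lemma matprod_cong:
  "(\<And>j. j \<in> set js \<Longrightarrow> f j = g j) \<Longrightarrow> matprod f js = matprod g js"
  by (induction js) auto

lemma matprod_map: "matprod f (map g js) = matprod (\<lambda>j. f (g j)) js"
  by (induction js) auto

lemma matrix_mul_sum_left: "(\<Sum>i\<in>I. f i) ** M = (\<Sum>i\<in>I. f i ** (M :: 'a::semiring_1^'n^'n))"
  by (simp add: vec_eq_iff matrix_matrix_mult_def sum_distrib_right)
    (intro allI sum.swap)

lemma matrix_mul_sum_right: "(M :: 'a::semiring_1^'n^'n) ** (\<Sum>i\<in>I. f i) = (\<Sum>i\<in>I. M ** f i)"
  by (simp add: vec_eq_iff matrix_matrix_mult_def sum_distrib_left)
    (intro allI sum.swap)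

lemma trace_sum: "trace (\<Sum>i\<in>I. f i) = (\<Sum>i\<in>I. trace (f i :: 'a::semiring_1^'n^'n))"
  unfolding trace_def by (simp add: sum.swap[of _ UNIV])

lemma norm_matprod_le:
  fixes f :: "'i \<Rightarrow> complex^'n^'n"
  assumes "\<And>j p q. j \<in> set js \<Longrightarrow> norm (f j $ p $ q) \<le> K" "K \<ge> 0"
  shows "norm (matprod f js $ p $ q) \<le> (real CARD('n) * K) ^ length js"
  using assms(1)
proof (induction js arbitrary: p)
  case (Cons j js)
  have "norm (matprod f (j # js) $ p $ q) \<le> (\<Sum>r\<in>UNIV. norm (f j $ p $ r * matprod f js $ r $ q))"
    unfolding matprod_simps by (simp add: matrix_matrix_mult_def norm_sum)
  also have "\<dots> \<le> (\<Sum>r::'n\<in>UNIV. K * (real CARD('n) * K) ^ length js)"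
    using Cons assms(2) by (intro sum_mono) (simp add: norm_mult mult_mono)
  finally show ?case
    by (simp add: mult_ac)
qed (simp add: mat_def)

section \<open>Kronecker products and entrywise conjugation\<close>

definition kron :: "'a::times^'n^'n \<Rightarrow> 'a^'m^'m \<Rightarrow> 'a^('n \<times> 'm)^('n \<times> 'm)" where
  "kron A B = (\<chi> p q. A $ fst p $ fst q * B $ snd p $ snd q)"

lemma sum_UNIV_prod: "(\<Sum>p\<in>UNIV. f p) = (\<Sum>x\<in>UNIV. \<Sum>y\<in>UNIV. f (x, y))"
  by (simp add: sum.cartesian_product)

lemma kron_mult:
  "kron A B ** kron A' B' = kron (A ** A') (B ** (B' :: 'a::comm_semiring_1^'m^'m))"
  by (simp add: kron_def vec_eq_iff matrix_matrix_mult_def sum_UNIV_prod sum_product mult_ac)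

lemma kron_mat_1: "kron (mat 1) (mat 1) = (mat 1 :: 'a::comm_semiring_1^_^_)"
  by (auto simp: kron_def vec_eq_iff mat_def prod_eq_iff)

lemma trace_kron: "trace (kron A B) = trace A * trace (B :: 'a::comm_semiring_1^'m^'m)"
  by (simp add: trace_def kron_def sum_UNIV_prod sum_product)

text \<open>With \<open>trace_kron\<close> it turns a product of amplitudes, each a trace of a
  matrix product, into one trace of a product of larger one-site matrices.\<close>

lemma kron_matprod:
  "kron (matprod f js) (matprod g js) = matprod (\<lambda>j. kron (f j) (g j :: 'a::comm_semiring_1^'m^'m)) js"
  by (induction js) (simp_all add: kron_mat_1 kron_mult[symmetric])

definition cnj_matrix :: "complex^'n^'m \<Rightarrow> complex^'n^'m" where
  "cnj_matrix A = (\<chi> i j. cnj (A $ i $ j))"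

lemma cnj_matprod: "cnj_matrix (matprod f js) = matprod (\<lambda>j. cnj_matrix (f j)) js"
proof (induction js)
  case (Cons j js)
  then show ?case
    unfolding matprod_simps Cons.IH[symmetric]
    by (simp add: cnj_matrix_def vec_eq_iff matrix_matrix_mult_def)
qed (simp add: cnj_matrix_def vec_eq_iff mat_def)

lemma trace_cnj_matrix: "trace (cnj_matrix A) = cnj (trace A)"
  by (simp add: trace_def cnj_matrix_def)

section \<open>Sums over configurations\<close>

lemma finite_configs [simp]: "finite S \<Longrightarrow> finite (configs S :: (nat \<Rightarrow> 'd::finite) set)"
  by (simp add: configs_def finite_PiE)

lemma sum_configs_insert:
  assumes "j \<notin> S"
  shows "(\<Sum>x\<in>configs (insert j S). g x) = (\<Sum>i\<in>UNIV. \<Sum>x\<in>configs S. g (x(j := i)))"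
proof -
  have "(\<Sum>x\<in>configs (insert j S). g x) = (\<Sum>(i, x)\<in>UNIV \<times> configs S. g (x(j := i)))"
    unfolding configs_def PiE_insert_eq using inj_combinator[OF assms, of "\<lambda>_. UNIV"]
    by (subst sum.reindex) (auto simp: case_prod_unfold)
  then show ?thesis
    by (simp add: sum.cartesian_product)
qed

text \<open>As the sites in \<open>js\<close> are distinct, each basis label occurs in the factor of
  its own site only, and distributivity moves every sum into its factor.\<close>

lemma sum_configs_matprod:
  fixes f :: "nat \<Rightarrow> 'd::finite \<Rightarrow> 'a::semiring_1^'n^'n"
  assumes "distinct js"
  shows "(\<Sum>x\<in>configs (set js). matprod (\<lambda>j. f j (x j)) js) = matprod (\<lambda>j. \<Sum>i\<in>UNIV. f j i) js"
  using assms
proof (induction js)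
  case (Cons j js)
  have upd: "matprod (\<lambda>k. f k ((x(j := i)) k)) js = matprod (\<lambda>k. f k (x k)) js" for x i
    using Cons.prems by (intro matprod_cong) auto
  have IH: "(\<Sum>x\<in>configs (set js). matprod (\<lambda>j. f j (x j)) js) = matprod (\<lambda>j. \<Sum>i\<in>UNIV. f j i) js"
    using Cons by simp
  have j: "j \<notin> set js"
    using Cons.prems by simp
  show ?case
    unfolding list.set sum_configs_insert[OF j] matprod_simps upd IH[symmetric]
      matrix_mul_sum_left matrix_mul_sum_right fun_upd_same
    by (rule sum.swap)
qed (simp add: configs_def)

lemma sum_configs_matprod2:
  fixes f :: "nat \<Rightarrow> 'd::finite \<Rightarrow> 'd \<Rightarrow> 'a::semiring_1^'n^'n"
  assumes "distinct js"
  shows "(\<Sum>u\<in>configs (set js). \<Sum>v\<in>configs (set js). matprod (\<lambda>j. f j (u j) (v j)) js)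
    = matprod (\<lambda>j. \<Sum>i\<in>UNIV. \<Sum>i'\<in>UNIV. f j i i') js"
  using sum_configs_matprod[OF assms, of "\<lambda>j. f j (_ j)"]
    sum_configs_matprod[OF assms, of "\<lambda>j i. \<Sum>i'\<in>UNIV. f j i i'"]
  by (simp add: sum_configs_matprod[OF assms])

text \<open>The trace of the square of the unnormalised reduced operator, written with two full
  configurations: \<open>override_on v u A\<close> agrees with \<open>u\<close> on \<open>A\<close>
  and with \<open>v\<close> elsewhere. In this form the summand factorises site by site once the
  amplitudes are matrix products.\<close>

definition purity :: "nat set \<Rightarrow> nat set \<Rightarrow> ((nat \<Rightarrow> 'd) \<Rightarrow> complex) \<Rightarrow> complex" where
  "purity S A \<psi> = (\<Sum>u\<in>configs S. \<Sum>v\<in>configs S.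
     \<psi> u * \<psi> v * cnj (\<psi> (override_on v u A)) * cnj (\<psi> (override_on u v A)))"

definition reduced :: "nat set \<Rightarrow> nat set \<Rightarrow> ((nat \<Rightarrow> 'd) \<Rightarrow> complex) \<Rightarrow> (nat \<Rightarrow> 'd) \<Rightarrow> (nat \<Rightarrow> 'd) \<Rightarrow> complex"
  where "reduced S A \<psi> = partial_trace S A (\<lambda>x y. \<psi> x * cnj (\<psi> y))"

section \<open>Purity through the reduced operator\<close>

lemma sum_configs_merge:
  fixes g :: "(nat \<Rightarrow> 'd::finite) \<Rightarrow> 'a::comm_monoid_add"
  assumes "A \<subseteq> S"
  shows "(\<Sum>u\<in>configs S. g u)
    = (\<Sum>x\<in>configs A. \<Sum>z\<in>configs (S - A). g (merge A (S - A) (x, z)))"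
  unfolding sum.cartesian_product
  by (rule sum.reindex_bij_witness[where i = "merge A (S - A)" and
        j = "\<lambda>u. (restrict u A, restrict u (S - A))"])
    (use assms in \<open>auto simp: configs_def merge_def PiE_iff extensional_def fun_eq_iff
        intro!: arg_cong[where f = g]\<close>)

lemma cnj_reduced: "cnj (reduced S A \<psi> x y) = reduced S A \<psi> y x"
  by (simp add: reduced_def partial_trace_def mult.commute)

lemma purity_eq_reduced:
  fixes \<psi> :: "(nat \<Rightarrow> 'd::finite) \<Rightarrow> complex"
  assumes "A \<subseteq> S"
  shows "purity S A \<psi> = (\<Sum>x\<in>configs A. \<Sum>y\<in>configs A. reduced S A \<psi> x y * reduced S A \<psi> y x)"
proof -
  let ?B = "S - A"
  let ?m = "\<lambda>x z. \<psi> (merge A ?B (x, z))"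
  have ov: "override_on (merge A ?B (y, w)) (merge A ?B (x, z)) A = merge A ?B (x, w)" for x y z w
    by (auto simp: override_on_def merge_def fun_eq_iff)
  have "purity S A \<psi> = (\<Sum>x\<in>configs A. \<Sum>z\<in>configs ?B. \<Sum>y\<in>configs A. \<Sum>w\<in>configs ?B.
      ?m x z * ?m y w * cnj (?m x w) * cnj (?m y z))"
    unfolding purity_def sum_configs_merge[OF assms] ov ..
  also have "\<dots> = (\<Sum>x\<in>configs A. \<Sum>y\<in>configs A. \<Sum>z\<in>configs ?B. \<Sum>w\<in>configs ?B.
      ?m x z * cnj (?m y z) * (?m y w * cnj (?m x w)))"
    by (subst sum.swap[of _ _ "configs ?B"]) (simp add: mult_ac)
  also have "\<dots> = (\<Sum>x\<in>configs A. \<Sum>y\<in>configs A. reduced S A \<psi> x y * reduced S A \<psi> y x)"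
    unfolding reduced_def partial_trace_def sum_product ..
  finally show ?thesis .
qed

lemma norm_square_eq_reduced:
  fixes \<psi> :: "(nat \<Rightarrow> 'd::finite) \<Rightarrow> complex"
  assumes "A \<subseteq> S"
  shows "norm_square S \<psi> = (\<Sum>x\<in>configs A. reduced S A \<psi> x x)"
  unfolding norm_square_def sum_configs_merge[OF assms] reduced_def partial_trace_def
  by (simp add: mult.commute)

lemma norm_square_eq: "norm_square S \<psi> = of_real (\<Sum>x\<in>configs S. (norm (\<psi> x))\<^sup>2)"
  unfolding norm_square_def of_real_sum complex_norm_square by (simp add: mult.commute)

text \<open>The reduced operator is Hermitian, so the trace of its square is its squared
  Hilbert-Schmidt norm.\<close>

lemma purity_eq:
  fixes \<psi> :: "(nat \<Rightarrow> 'd::finite) \<Rightarrow> complex"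
  assumes "A \<subseteq> S"
  shows "purity S A \<psi> = of_real (\<Sum>x\<in>configs A. \<Sum>y\<in>configs A. (norm (reduced S A \<psi> x y))\<^sup>2)"
  unfolding purity_eq_reduced[OF assms] of_real_sum complex_norm_square cnj_reduced ..

lemma Re_purity_nonneg: "A \<subseteq> S \<Longrightarrow> Re (purity S A (\<psi> :: (nat \<Rightarrow> 'd::finite) \<Rightarrow> complex)) \<ge> 0"
  by (simp add: purity_eq sum_nonneg)

text \<open>A nonzero trace forces a nonzero diagonal entry. Positivity matters for the logarithm:
  as \<open>ln 0 = 0\<close>, a small quotient yields a large entropy only if it is not
  zero.\<close>

lemma Re_purity_pos:
  fixes \<psi> :: "(nat \<Rightarrow> 'd::finite) \<Rightarrow> complex"
  assumes "finite S" "A \<subseteq> S" "norm_square S \<psi> \<noteq> 0"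
  shows "Re (purity S A \<psi>) > 0"
proof -
  have fin: "finite (configs A :: (nat \<Rightarrow> 'd) set)"
    using assms by (simp add: finite_subset)
  obtain x where x: "x \<in> configs A" "reduced S A \<psi> x x \<noteq> 0"
    using assms(3) unfolding norm_square_eq_reduced[OF assms(2)] by (meson sum.neutral)
  have "0 < (norm (reduced S A \<psi> x x))\<^sup>2"
    using x by simp
  also have "\<dots> \<le> (\<Sum>y\<in>configs A. (norm (reduced S A \<psi> x y))\<^sup>2)"
    using x fin by (intro member_le_sum) auto
  also have "\<dots> \<le> (\<Sum>x\<in>configs A. \<Sum>y\<in>configs A. (norm (reduced S A \<psi> x y))\<^sup>2)"
    using x fin by (intro member_le_sum) (auto intro: sum_nonneg)
  finally show ?thesis
    by (simp add: purity_eq[OF assms(2)])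
qed

text \<open>This makes the second moment of the norm an instance of the purity computation, the one
  with no site traced out.\<close>

lemma purity_all: "purity S S \<psi> = (norm_square S (\<psi> :: (nat \<Rightarrow> 'd::finite) \<Rightarrow> complex))\<^sup>2"
proof -
  have "override_on v u S = u" if "u \<in> configs S" "v \<in> configs S" for u v :: "nat \<Rightarrow> 'd"
    using that by (auto simp: override_on_def configs_def PiE_iff extensional_def fun_eq_iff)
  then show ?thesis
    by (simp add: purity_def norm_square_def power2_eq_square sum_product mult_ac)
qed

text \<open>Norm zero is included, since both sides then take the logarithm of zero through division
  by zero.\<close>

lemma renyi2_entropy_eq:
  fixes \<psi> :: "(nat \<Rightarrow> 'd::finite) \<Rightarrow> complex"
  assumes "A \<subseteq> S"
  shows "renyi2_entropy A (partial_trace S A (density_matrix S \<psi>))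
    = - ln (Re (purity S A \<psi>) / (Re (norm_square S \<psi>))\<^sup>2)"
proof -
  have "partial_trace S A (density_matrix S \<psi>) x y = reduced S A \<psi> x y / norm_square S \<psi>" for x y
    by (simp add: reduced_def partial_trace_def density_matrix_def sum_divide_distrib)
  then have "op_trace A (op_mult A (partial_trace S A (density_matrix S \<psi>))
      (partial_trace S A (density_matrix S \<psi>))) = purity S A \<psi> / (norm_square S \<psi>)\<^sup>2"
    by (simp add: op_trace_def op_mult_def purity_eq_reduced[OF assms] sum_divide_distrib
        power2_eq_square)
  moreover have "Re (purity S A \<psi> / (norm_square S \<psi>)\<^sup>2)
      = Re (purity S A \<psi>) / (Re (norm_square S \<psi>))\<^sup>2"
    unfolding norm_square_eq by (simp del: of_real_sum add: of_real_power[symmetric] del: of_real_power)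
  ultimately show ?thesis
    by (simp add: renyi2_entropy_def)
qed

text \<open>The index consists of four bond indices, two for the amplitudes and two for the
  conjugates. \<open>s\<close> holds at sites of \<open>A\<close>, where the conjugates carry the
  physical labels in the order of the amplitudes; at a traced out site the labels are
  exchanged.\<close>

definition site ::
    "'d::finite \<Rightarrow> bool \<Rightarrow> complex^('d \<times> 'b::finite)^('d \<times> 'b)
      \<Rightarrow> complex^(('b \<times> 'b) \<times> ('b \<times> 'b))^(('b \<times> 'b) \<times> ('b \<times> 'b))" where
  "site e0 s W = (\<Sum>i\<in>UNIV. \<Sum>i'\<in>UNIV.
     kron (kron (mps_matrix e0 W i) (mps_matrix e0 W i'))
       (kron (cnj_matrix (mps_matrix e0 W (if s then i else i')))
         (cnj_matrix (mps_matrix e0 W (if s then i' else i)))))"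

definition site1 ::
    "'d::finite \<Rightarrow> complex^('d \<times> 'b::finite)^('d \<times> 'b) \<Rightarrow> complex^('b \<times> 'b)^('b \<times> 'b)" where
  "site1 e0 W = (\<Sum>i\<in>UNIV. kron (cnj_matrix (mps_matrix e0 W i)) (mps_matrix e0 W i))"

section \<open>Norm and purity as traces of products\<close>

lemma mps_eq: "mps e0 n U x = trace (matprod (\<lambda>j. mps_matrix e0 (U j) (x j)) [1..<Suc n])"
  by (simp add: mps_def matprod_def)

lemma set_sites: "{1..n} = set [1..<Suc n]"
  by auto

lemma purity_mps:
  "purity {1..n} A (mps e0 n U) = trace (matprod (\<lambda>j. site e0 (j \<in> A) (U j)) [1..<Suc n])"
proof -
  let ?js = "[1..<Suc n]"
  let ?a = "\<lambda>j. mps_matrix e0 (U j)"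
  let ?K = "\<lambda>j i i'. kron (kron (?a j i) (?a j i'))
    (kron (cnj_matrix (?a j (if j \<in> A then i else i'))) (cnj_matrix (?a j (if j \<in> A then i' else i))))"
  have "mps e0 n U u * mps e0 n U v * cnj (mps e0 n U (override_on v u A)) *
      cnj (mps e0 n U (override_on u v A)) = trace (matprod (\<lambda>j. ?K j (u j) (v j)) ?js)" for u v
  proof -
    have "mps e0 n U u * mps e0 n U v * cnj (mps e0 n U (override_on v u A)) *
      cnj (mps e0 n U (override_on u v A)) = (mps e0 n U u * mps e0 n U v) *
      (cnj (mps e0 n U (override_on v u A)) * cnj (mps e0 n U (override_on u v A)))"
      by (simp only: mult.assoc)
    also have "\<dots> = trace (matprod (\<lambda>j. kron (kron (?a j (u j)) (?a j (v j)))
        (kron (cnj_matrix (?a j (override_on v u A j))) (cnj_matrix (?a j (override_on u v A j))))) ?js)"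
      unfolding mps_eq trace_cnj_matrix[symmetric] cnj_matprod trace_kron[symmetric] kron_matprod ..
    also have "\<dots> = trace (matprod (\<lambda>j. ?K j (u j) (v j)) ?js)"
      by (simp only: override_on_def if_distrib[where f = "\<lambda>i. cnj_matrix (mps_matrix _ _ i)"])
    finally show ?thesis .
  qed
  then have "purity {1..n} A (mps e0 n U) = (\<Sum>u\<in>configs (set ?js). \<Sum>v\<in>configs (set ?js).
      trace (matprod (\<lambda>j. ?K j (u j) (v j)) ?js))"
    unfolding purity_def set_sites by simp
  also have "\<dots> = trace (matprod (\<lambda>j. site e0 (j \<in> A) (U j)) ?js)"
    unfolding trace_sum[symmetric] site_def
    by (rule arg_cong[where f = trace], rule sum_configs_matprod2[where f = ?K]) simp
  finally show ?thesis .
qed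

lemma norm_square_mps:
  "norm_square {1..n} (mps e0 n U) = trace (matprod (\<lambda>j. site1 e0 (U j)) [1..<Suc n])"
  unfolding norm_square_def mps_eq trace_cnj_matrix[symmetric] cnj_matprod trace_kron[symmetric]
    kron_matprod trace_sum[symmetric] site1_def set_sites
  by (subst sum_configs_matprod) simp_all

section \<open>The averaged transfer matrices\<close>

text \<open>The one-site second moment map in the basis of the two pairings of the virtual indices, for
  a site on which the two copies of the state are paired trivially (\<open>s\<close>) or crosswise (\<open>\<not> s\<close>).\<close>

definition pair_transfer :: "real \<Rightarrow> real \<Rightarrow> bool \<Rightarrow> real^2^2" where
  "pair_transfer d D s = (let K = (d * D)\<^sup>2 - 1 in
     if s then vector [vector [(d\<^sup>2 * D\<^sup>2 - d) / K, D * d * (d - 1) / K],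
                       vector [D * (d - 1) / K, (d * D\<^sup>2 - 1) / K]]
     else vector [vector [(d * D\<^sup>2 - 1) / K, D * (d - 1) / K],
                  vector [D * d * (d - 1) / K, (d\<^sup>2 * D\<^sup>2 - d) / K]])"

text \<open>This is the eigenvalue \<lambda> < 1 of \<open>pair_transfer d D True\<close>, whose
  other eigenvalue is 1. It is also the determinant of both kinds of matrix.\<close>

definition gap :: "real \<Rightarrow> real \<Rightarrow> real" where
  "gap d D = d * (D\<^sup>2 - 1) / ((d * D)\<^sup>2 - 1)"

section \<open>Determinants and nonnegative matrices\<close>

lemma det_matprod: "det (matprod f js) = (\<Prod>j\<leftarrow>js. det (f j :: real^'n^'n))"
  by (induction js) (simp_all add: det_mul)

lemma matprod_nonneg:
  fixes f :: "'i \<Rightarrow> real^'n^'n"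
  assumes "\<And>j p q. j \<in> set js \<Longrightarrow> 0 \<le> f j $ p $ q"
  shows "0 \<le> matprod f js $ p $ q"
  using assms
  by (induction js arbitrary: p) (auto simp: mat_def matrix_matrix_mult_def intro!: sum_nonneg)

lemma matrix_vector_mult_2: "(A *v x) $ i = A $ i $ 1 * x $ 1 + A $ i $ 2 * x $ 2"
  for A :: "real^2^2"
  by (simp add: matrix_vector_mult_def sum_2)

lemma det_one_minus_2: "det (mat 1 - A) = 1 - trace A + det A" for A :: "real^2^2"
  by (simp add: det_2 trace_def sum_2 mat_def algebra_simps)

lemma matrix_vector_mono:
  fixes A :: "real^'n^'n"
  assumes "\<And>p q. 0 \<le> A $ p $ q" "\<And>i. x $ i \<le> y $ i"
  shows "(A *v x) $ i \<le> (A *v y) $ i"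
  using assms by (simp add: matrix_vector_mult_def sum_mono mult_left_mono)

text \<open>After conjugation with the diagonal matrix of the positive vector the row sums are at
  most \<open>q\<close>. Hence each diagonal entry is at most \<open>q\<close> minus the
  off-diagonal entry of its row. With x and y for the latter, (x + 1 - q) (y + 1 - q) \<ge> x y + (1
  - q)^2 bounds the determinant.\<close>

lemma trace_bounds_2:
  fixes A :: "real^2^2"
  assumes "D > 0" "q \<le> 1" and nn: "\<And>i j. 0 \<le> A $ i $ j"
    and "\<And>i. (A *v vector [1, 1 / D]) $ i \<le> q * vector [1, 1 / D] $ i"
  shows "trace A \<le> 2 * q" "(1 - q)\<^sup>2 \<le> det (mat 1 - A)"
proof -
  have 1: "A $ 1 $ 1 + A $ 1 $ 2 / D \<le> q"
    using assms(4)[of 1] by (simp add: matrix_vector_mult_2)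
  have "D * (A $ 2 $ 1 + A $ 2 $ 2 / D) \<le> D * (q / D)"
    using assms(4)[of 2] \<open>D > 0\<close> by (intro mult_left_mono) (simp_all add: matrix_vector_mult_2)
  then have 2: "D * A $ 2 $ 1 + A $ 2 $ 2 \<le> q"
    using \<open>D > 0\<close> by (simp add: distrib_left)
  have p: "0 \<le> A $ 1 $ 2 / D" "0 \<le> D * A $ 2 $ 1"
    using nn \<open>D > 0\<close> by simp_all
  show "trace A \<le> 2 * q"
    using 1 2 p by (simp add: trace_def sum_2)
  have gen: "c\<^sup>2 + x * y \<le> (x + c) * (y + c)" if "0 \<le> x" "0 \<le> y" "0 \<le> c" for x y c :: real
    using mult_nonneg_nonneg[OF that(1,3)] mult_nonneg_nonneg[OF that(2,3)]
    by (simp add: algebra_simps power2_eq_square)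
  have "(1 - q)\<^sup>2 + A $ 1 $ 2 * A $ 2 $ 1 = (1 - q)\<^sup>2 + (A $ 1 $ 2 / D) * (D * A $ 2 $ 1)"
    using \<open>D > 0\<close> by simp
  also have "\<dots> \<le> (A $ 1 $ 2 / D + (1 - q)) * (D * A $ 2 $ 1 + (1 - q))"
    using p \<open>q \<le> 1\<close> by (intro gen) auto
  also have "\<dots> \<le> (1 - A $ 1 $ 1) * (1 - A $ 2 $ 2)"
    using 1 2 p \<open>q \<le> 1\<close> by (intro mult_mono) auto
  finally show "(1 - q)\<^sup>2 \<le> det (mat 1 - A)"
    by (simp add: det_2 mat_def)
qed

section \<open>The transfer matrices for dimensions at least two\<close>

context
  fixes d D :: real
  assumes d: "d \<ge> 2" and D: "D \<ge> 2"
begin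

lemma K_pos: "(d * D)\<^sup>2 - 1 > 0"
proof -
  have "1 < d * D"
    using d D mult_mono[of 2 d 2 D] by simp
  then show ?thesis
    by (simp add: one_less_power)
qed

lemma pair_transfer_nonneg: "0 \<le> pair_transfer d D s $ i $ j"
proof -
  have "d * 1 \<le> d * (d * D\<^sup>2)" "1 \<le> d * D\<^sup>2"
    using d D mult_mono[of 1 d 1 "D\<^sup>2"] by (auto intro!: mult_left_mono simp: one_le_power)
  then have "d \<le> d\<^sup>2 * D\<^sup>2" "1 \<le> d * D\<^sup>2"
    by (simp_all add: power2_eq_square mult_ac)
  then show ?thesis
    using K_pos d D exhaust_2[of i] exhaust_2[of j]
    by (auto simp: pair_transfer_def Let_def)
qed

lemma gap_pos: "0 < gap d D" and gap_less_1: "gap d D < 1"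
proof -
  have D2: "D\<^sup>2 > 1"
    using D by (simp add: one_less_power)
  then show "0 < gap d D"
    using d K_pos by (simp add: gap_def)
  have "(d * D)\<^sup>2 - 1 - d * (D\<^sup>2 - 1) = (d - 1) * (d * D\<^sup>2 + 1)"
    by (simp add: algebra_simps power2_eq_square)
  moreover have "\<dots> > 0"
    using d D by (intro mult_pos_pos add_nonneg_pos) auto
  ultimately show "gap d D < 1"
    using K_pos by (simp add: gap_def)
qed

text \<open>Exchanging the two pairings, that is both rows and columns, maps one kind of matrix to
  the other, so one computation covers both.\<close>

lemma det_pair_transfer: "det (pair_transfer d D s) = gap d D"
proof -
  have "(d\<^sup>2 * D\<^sup>2 - d) * (d * D\<^sup>2 - 1) - D * d * (d - 1) * (D * (d - 1))
      = d * (D\<^sup>2 - 1) * ((d * D)\<^sup>2 - 1)"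
    by (simp add: algebra_simps power2_eq_square)
  then have "(d\<^sup>2 * D\<^sup>2 - d) / ((d * D)\<^sup>2 - 1) * ((d * D\<^sup>2 - 1) / ((d * D)\<^sup>2 - 1))
      - D * d * (d - 1) / ((d * D)\<^sup>2 - 1) * (D * (d - 1) / ((d * D)\<^sup>2 - 1)) = gap d D"
    using K_pos by (simp add: gap_def diff_divide_distrib[symmetric])
  then show ?thesis
    by (cases s) (simp_all add: pair_transfer_def Let_def det_2 mult.commute)
qed

text \<open>The matrix is \<open>gap d D\<close> times the identity plus a multiple of the outer
  product of the vector (1, 1 / (d D)) and the functional (1, 1 / D).\<close>

lemma pair_transfer_True_entries:
  shows "pair_transfer d D True $ 1 $ 1 = gap d D + d * D\<^sup>2 * (d - 1) / ((d * D)\<^sup>2 - 1)"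
    "pair_transfer d D True $ 1 $ 2 = d * D\<^sup>2 * (d - 1) / ((d * D)\<^sup>2 - 1) / D"
    "pair_transfer d D True $ 2 $ 1 = d * D\<^sup>2 * (d - 1) / ((d * D)\<^sup>2 - 1) / (d * D)"
    "pair_transfer d D True $ 2 $ 2 = gap d D + d * D\<^sup>2 * (d - 1) / ((d * D)\<^sup>2 - 1) / (d * D\<^sup>2)"
  using K_pos d D
  by (simp_all add: pair_transfer_def Let_def gap_def add_divide_distrib[symmetric])
    (simp_all add: field_simps power2_eq_square)

text \<open>The rank one part has the eigenvalue \<open>1 - gap d D\<close>, so the whole matrix
  fixes its range.\<close>

lemma gap_complement:
  "d * D\<^sup>2 * (d - 1) / ((d * D)\<^sup>2 - 1) * (1 + 1 / (d * D\<^sup>2)) = 1 - gap d D"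
  using K_pos d D by (simp add: gap_def divide_simps) (simp add: algebra_simps power2_eq_square)

text \<open>The functional \<open>y $ 1 + y $ 2 / D\<close> is preserved, and \<open>vector [1, 1 / (d * D)]\<close> is the
  fixed vector: powers of the map contract towards it with ratio \<open>gap d D\<close>.\<close>

lemma pair_transfer_True_apply:
  defines "r \<equiv> vector [1, 1 / (d * D)] :: real^2"
  shows "(pair_transfer d D True *v y) $ i
    = gap d D * y $ i + (1 - gap d D) * ((y $ 1 + y $ 2 / D) / (1 + 1 / (d * D\<^sup>2)) * r $ i)"
proof -
  define \<rho> where "\<rho> = d * D\<^sup>2 * (d - 1) / ((d * D)\<^sup>2 - 1)"
  have "1 + 1 / (d * D\<^sup>2) > 0"
    using d D by (intro add_pos_nonneg) auto
  then have "(1 - gap d D) * (x / (1 + 1 / (d * D\<^sup>2)) * r $ i) = \<rho> * x * r $ i" for x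
    unfolding gap_complement[symmetric] \<rho>_def by simp
  then have \<rho>: "(1 - gap d D) * (x / (1 + 1 / (d * D\<^sup>2)) * r $ i) = \<rho> * x * r $ i" for x .
  note E = pair_transfer_True_entries[folded \<rho>_def]
  have "(pair_transfer d D True *v y) $ i = gap d D * y $ i + \<rho> * (y $ 1 + y $ 2 / D) * r $ i"
    using exhaust_2[of i]
    by (elim disjE; simp only: matrix_vector_mult_2 E r_def vector_2)
      (simp_all add: distrib_left distrib_right add_divide_distrib power2_eq_square)
  then show ?thesis
    unfolding \<rho> .
qed

lemma pair_transfer_True_preserves:
  "(pair_transfer d D True *v y) $ 1 + (pair_transfer d D True *v y) $ 2 / D = y $ 1 + y $ 2 / D"
proof -
  have p: "1 + 1 / (d * D\<^sup>2) > 0"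
    using d D by (intro add_pos_nonneg) auto
  define c where "c = (y $ 1 + y $ 2 / D) / (1 + 1 / (d * D\<^sup>2))"
  have c: "y $ 1 + y $ 2 / D = c * (1 + 1 / (d * D\<^sup>2))"
    using p by (simp add: c_def)
  show ?thesis
  proof -
    have "(pair_transfer d D True *v y) $ 1 + (pair_transfer d D True *v y) $ 2 / D
        = gap d D * (y $ 1 + y $ 2 / D) + (1 - gap d D) * (c * (1 + 1 / (d * D\<^sup>2)))"
      unfolding pair_transfer_True_apply c_def[symmetric]
      by (simp add: distrib_left add_divide_distrib power2_eq_square mult.assoc mult.left_commute)
    then show ?thesis
      unfolding c[symmetric] by (simp add: left_diff_distrib)
  qed
qed

section \<open>Contraction by one block\<close>

lemma swap_vector:
  defines "w \<equiv> pair_transfer d D False *v vector [1, 1 / D]"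
  shows "w $ 1 = (d * D\<^sup>2 + d - 2) / ((d * D)\<^sup>2 - 1)"
    "w $ 2 = (2 * D\<^sup>2 * d\<^sup>2 - D\<^sup>2 * d - d) / D / ((d * D)\<^sup>2 - 1)"
proof -
  define K where "K = (d * D)\<^sup>2 - 1"
  have K: "K > 0" using K_pos by (simp add: K_def)
  show "w $ 1 = (d * D\<^sup>2 + d - 2) / ((d * D)\<^sup>2 - 1)"
    "w $ 2 = (2 * D\<^sup>2 * d\<^sup>2 - D\<^sup>2 * d - d) / D / ((d * D)\<^sup>2 - 1)"
    unfolding w_def matrix_vector_mult_2 pair_transfer_def Let_def K_def[symmetric]
    using K D by (simp_all add: field_simps power2_eq_square)
qed

text \<open>A traced out site alone does not contract: it raises the second coordinate above
  \<open>1 / D\<close>. One further site of \<open>A\<close> suffices, and a block of length at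
  least two provides it. The differences are rewritten as polynomials whose terms visibly have the
  right sign for \<open>d\<close> and \<open>D\<close> at least 2.\<close>

lemma swap_contraction_first:
  defines "w \<equiv> pair_transfer d D False *v vector [1, 1 / D]"
  defines "y \<equiv> pair_transfer d D True *v w"
  shows "y $ 1 < 1" "y $ 2 < 1 / D"
proof -
  define K where "K = (d * D)\<^sup>2 - 1"
  have K: "K > 0" using K_pos by (simp add: K_def)
  have D2: "D\<^sup>2 \<ge> 4"
    using D power_mono[of 2 D 2] by simp
  note w = swap_vector[folded w_def K_def]
  have id_entries: "pair_transfer d D True $ 1 $ 1 = (d\<^sup>2 * D\<^sup>2 - d) / K"
    "pair_transfer d D True $ 1 $ 2 = D * d * (d - 1) / K"
    "pair_transfer d D True $ 2 $ 1 = D * (d - 1) / K"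
    "pair_transfer d D True $ 2 $ 2 = (d * D\<^sup>2 - 1) / K"
    by (simp_all add: pair_transfer_def Let_def K_def)
  have "y $ 1 = ((d\<^sup>2 * D\<^sup>2 - d) * (d * D\<^sup>2 + d - 2)
      + d * (d - 1) * (2 * D\<^sup>2 * d\<^sup>2 - D\<^sup>2 * d - d)) / K\<^sup>2"
    unfolding y_def matrix_vector_mult_2[of _ w] w id_entries
    using K D by (simp add: field_simps power2_eq_square)
  moreover have "K\<^sup>2 - ((d\<^sup>2 * D\<^sup>2 - d) * (d * D\<^sup>2 + d - 2)
      + d * (d - 1) * (2 * D\<^sup>2 * d\<^sup>2 - D\<^sup>2 * d - d))
      = d^3 * (d - 1) * (D\<^sup>2 * (D\<^sup>2 - 2)) + (d * (d\<^sup>2 - 2) + 1)"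
    unfolding K_def by algebra
  moreover have "\<dots> > 0"
  proof (intro add_nonneg_pos)
    show "0 \<le> d^3 * (d - 1) * (D\<^sup>2 * (D\<^sup>2 - 2))"
      using d D D2 by simp
    show "0 \<le> d * (d\<^sup>2 - 2)"
      using d power_mono[of 2 d 2] by simp
  qed simp
  ultimately show "y $ 1 < 1"
    using K by simp
  have "D * y $ 2 = (D\<^sup>2 * (d - 1) * (d * D\<^sup>2 + d - 2)
      + (d * D\<^sup>2 - 1) * (2 * D\<^sup>2 * d\<^sup>2 - D\<^sup>2 * d - d)) / K\<^sup>2"
    unfolding y_def matrix_vector_mult_2[of _ w] w id_entries
    using K D by (simp add: field_simps power2_eq_square)
  moreover have "K\<^sup>2 - (D\<^sup>2 * (d - 1) * (d * D\<^sup>2 + d - 2)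
      + (d * D\<^sup>2 - 1) * (2 * D\<^sup>2 * d\<^sup>2 - D\<^sup>2 * d - d))
      = d * D^4 * (d\<^sup>2 * (d - 2) + 1) + (2 * D\<^sup>2 - 1) * (d - 1)"
    unfolding K_def by algebra
  moreover have "\<dots> > 0"
    using d D D2 by (intro add_nonneg_pos mult_pos_pos) auto
  ultimately have "D * y $ 2 < 1"
    using K by simp
  then show "y $ 2 < 1 / D"
    using D by (simp add: field_simps)
qed

text \<open>The quotient is the multiple of the fixed vector that is approached when more and more
  sites of \<open>A\<close> follow the traced out one; being below 1, it makes long blocks contract
  too.\<close>

lemma swap_contraction_limit:
  defines "w \<equiv> pair_transfer d D False *v vector [1, 1 / D]"
  shows "(w $ 1 + w $ 2 / D) / (1 + 1 / (d * D\<^sup>2)) < 1"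
proof -
  define K where "K = (d * D)\<^sup>2 - 1"
  have K: "K > 0" using K_pos by (simp add: K_def)
  have D2: "D\<^sup>2 \<ge> 4"
    using D power_mono[of 2 D 2] by simp
  have p: "d * D\<^sup>2 > 0"
    using d D by simp
  have "K * (d * D\<^sup>2) * (w $ 1 + w $ 2 / D) = d * D\<^sup>2 * (d * D\<^sup>2 + d - 2)
      + d * (2 * D\<^sup>2 * d\<^sup>2 - D\<^sup>2 * d - d)"
    using K D unfolding w_def swap_vector K_def[symmetric]
    by (simp add: field_simps power2_eq_square)
  moreover have "K * (d * D\<^sup>2) * (1 + 1 / (d * D\<^sup>2)) = K * (d * D\<^sup>2 + 1)"
    using p d D by (simp add: distrib_left)
  moreover have "K * (d * D\<^sup>2 + 1) - (d * D\<^sup>2 * (d * D\<^sup>2 + d - 2)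
      + d * (2 * D\<^sup>2 * d\<^sup>2 - D\<^sup>2 * d - d))
      = d\<^sup>2 * D\<^sup>2 * ((d - 1) * D\<^sup>2 - 2 * d + 1) + (d * D\<^sup>2 + (d\<^sup>2 - 1))"
    unfolding K_def by algebra
  moreover have "\<dots> > 0"
  proof (rule add_nonneg_pos)
    have "(d - 1) * 4 \<le> (d - 1) * D\<^sup>2"
      using d D2 by (intro mult_left_mono) auto
    then show "0 \<le> d\<^sup>2 * D\<^sup>2 * ((d - 1) * D\<^sup>2 - 2 * d + 1)"
      using d by (intro mult_nonneg_nonneg) auto
    show "0 < d * D\<^sup>2 + (d\<^sup>2 - 1)"
      using d p by (intro add_pos_nonneg) (simp_all add: one_le_power)
  qed
  ultimately have "K * (d * D\<^sup>2) * (w $ 1 + w $ 2 / D) < K * (d * D\<^sup>2) * (1 + 1 / (d * D\<^sup>2))"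
    by linarith
  then have "w $ 1 + w $ 2 / D < 1 + 1 / (d * D\<^sup>2)"
    using K p by (simp add: mult_less_cancel_left_pos)
  moreover have "0 < 1 + 1 / (d * D\<^sup>2)"
    using p by (simp add: add_pos_nonneg)
  ultimately show ?thesis
    by simp
qed

text \<open>Each further site of \<open>A\<close> replaces the vector by a convex combination of
  itself and the limit. First iterate and limit lie below \<open>q\<close> times the positive
  vector, hence all iterates do, and \<open>q\<close> does not depend on the block length. The list
  \<open>xs\<close> serves as a counter.\<close>

lemma swap_contraction:
  obtains q where "0 < q" "q < 1"
    "\<And>(xs :: nat list) i. xs \<noteq> [] \<Longrightarrow> (matprod (\<lambda>_. pair_transfer d D True) xs
       *v (pair_transfer d D False *v vector [1, 1 / D])) $ i \<le> q * vector [1, 1 / D] $ i"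
proof -
  let ?M = "pair_transfer d D True" and ?v = "vector [1, 1 / D] :: real^2"
  define w where "w = pair_transfer d D False *v ?v"
  define c where "c = (w $ 1 + w $ 2 / D) / (1 + 1 / (d * D\<^sup>2))"
  define r :: "real^2" where "r = vector [1, 1 / (d * D)]"
  \<comment> \<open>The limit contributes \<open>c\<close>, the first iterate its ratio to the
    positive vector in each coordinate, and \<open>1 / 2\<close> ensures that \<open>q\<close> is
    positive.\<close>
  define q where "q = Max {1 / 2, c, (?M *v w) $ 1, D * (?M *v w) $ 2}"
  have y: "(?M *v w) $ 1 < 1" "D * (?M *v w) $ 2 < 1" and c: "c < 1"
    using swap_contraction_first swap_contraction_limit D
    by (simp_all add: w_def c_def field_simps)
  have q: "0 < q" "q < 1"
    using y c unfolding q_def by (auto simp: less_max_iff_disj)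
  have ql: "c \<le> q" "(?M *v w) $ 1 \<le> q" "D * (?M *v w) $ 2 \<le> q"
    unfolding q_def by (rule Max_ge; simp)+
  have first: "(?M *v w) $ i \<le> q * ?v $ i" for i
    using ql exhaust_2[of i] D by (auto simp: field_simps)
  have limit: "c * r $ i \<le> q * ?v $ i" for i
  proof -
    have "c * (1 / (d * D)) \<le> q * (1 / (d * D))"
      using ql d D by (intro mult_right_mono) auto
    also have "\<dots> \<le> q * (1 / D)"
      using q d D by (intro mult_left_mono divide_left_mono) auto
    finally show ?thesis
      using ql exhaust_2[of i] by (auto simp: r_def)
  qed
  \<comment> \<open>The preserved functional is carried through the induction because its value
    fixes the limit \<open>c * r $ i\<close> for all iterates.\<close>
  have "(matprod (\<lambda>_. ?M) xs *v w) $ i \<le> q * ?v $ i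
      \<and> (matprod (\<lambda>_. ?M) xs *v w) $ 1 + (matprod (\<lambda>_. ?M) xs *v w) $ 2 / D = w $ 1 + w $ 2 / D"
    if "xs \<noteq> []" for xs :: "nat list" and i
    using that
  proof (induction xs arbitrary: i rule: list_nonempty_induct)
    case (single x)
    then show ?case
      using first pair_transfer_True_preserves by simp
  next
    case (cons x xs)
    let ?y = "matprod (\<lambda>_. ?M) xs *v w"
    have M: "matprod (\<lambda>_. ?M) (x # xs) *v w = ?M *v ?y"
      by (simp add: matrix_vector_mul_assoc)
    have "(?M *v ?y) $ i = gap d D * ?y $ i + (1 - gap d D) * (c * r $ i)"
      unfolding pair_transfer_True_apply c_def r_def using cons.IH by simp
    also have "\<dots> \<le> gap d D * (q * ?v $ i) + (1 - gap d D) * (q * ?v $ i)"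
      using cons.IH limit[of i] gap_pos gap_less_1 by (intro add_mono mult_left_mono) auto
    also have "\<dots> = q * ?v $ i"
      by (simp add: algebra_simps)
    finally show ?case
      unfolding M pair_transfer_True_preserves using cons.IH by simp
  qed
  then show ?thesis
    using q that unfolding w_def by blast
qed

text \<open>The preserved functional gives the eigenvalue 1, so the identity minus the product is
  singular and the trace is 1 plus the determinant.\<close>

lemma trace_pair_transfer_True:
  "trace (matprod (\<lambda>_. pair_transfer d D True) xs) = 1 + gap d D ^ length xs"
proof -
  let ?A = "matprod (\<lambda>_. pair_transfer d D True) xs"
  have "(?A *v y) $ 1 + (?A *v y) $ 2 / D = y $ 1 + y $ 2 / D" for y
    by (induction xs) (simp_all add: matrix_vector_mul_assoc[symmetric] pair_transfer_True_preserves)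
  from this[of "vector [1, 0]"] this[of "vector [0, 1]"]
  have e: "?A $ 1 $ 1 = 1 - ?A $ 2 $ 1 / D" "?A $ 1 $ 2 = 1 / D - ?A $ 2 $ 2 / D"
    by (simp_all add: matrix_vector_mult_2)
  have "det (mat 1 - ?A) = 0"
    unfolding det_2 by (simp add: mat_def e algebra_simps diff_divide_distrib)
  moreover have "det ?A = gap d D ^ length xs"
    by (simp add: det_matprod det_pair_transfer map_replicate_const)
  ultimately show ?thesis
    by (simp add: det_one_minus_2)
qed

section \<open>Chains of blocks\<close>

lemma upt_Suc_mult: "[1..<Suc (k * Suc m)] = [1..<Suc (k * m)] @ map (\<lambda>j. j + k * m) [1..<Suc k]"
proof -
  have "[1..<Suc (k * Suc m)] = [1..<Suc (k * m)] @ [Suc (k * m)..<Suc (k * m) + k]"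
    using upt_add_eq_append[of 1 "Suc (k * m)" k] by (simp add: add.commute)
  moreover have "[Suc (k * m)..<Suc (k * m) + k] = map (\<lambda>j. j + k * m) [1..<Suc k]"
    by (rule nth_equalityI) (auto simp del: upt_Suc)
  ultimately show ?thesis
    by simp
qed

text \<open>Nonnegative entries let the contractions of successive blocks multiply. The first bound
  decays with the number of blocks; the second, obtained through the determinant, keeps the trace a
  fixed amount below \<open>1 + gap d D ^ (k * m)\<close>, the second moment of the norm, however
  few blocks there are.\<close>

lemma pair_transfer_chain:
  obtains q where "0 < q" "q < 1"
    "\<And>k m. k \<ge> 2 \<Longrightarrow> trace (matprod (\<lambda>j. pair_transfer d D (\<not> k dvd j)) [1..<Suc (k * m)]) \<le> 2 * q ^ m"
    "\<And>k m. k \<ge> 2 \<Longrightarrow> m > 0 \<Longrightarrow>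
       trace (matprod (\<lambda>j. pair_transfer d D (\<not> k dvd j)) [1..<Suc (k * m)])
         \<le> 1 + gap d D ^ (k * m) - (1 - q)\<^sup>2"
proof -
  obtain q where q: "0 < q" "q < 1" and contr:
    "\<And>(xs :: nat list) i. xs \<noteq> [] \<Longrightarrow> (matprod (\<lambda>_. pair_transfer d D True) xs
       *v (pair_transfer d D False *v vector [1, 1 / D])) $ i \<le> q * vector [1, 1 / D] $ i"
    using swap_contraction by blast
  let ?v = "vector [1, 1 / D] :: real^2"
  let ?f = "\<lambda>k j. pair_transfer d D (\<not> k dvd j)"
  have block: "(matprod (?f k) [1..<Suc k] *v ?v) $ i \<le> q * ?v $ i" if "k \<ge> 2" for k :: nat and i
  proof -
    \<comment> \<open>On column vectors the last site of the block acts first, and this is the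
      traced out site \<open>k\<close>; the sites before it belong to \<open>A\<close>.\<close>
    have "matprod (?f k) [1..<Suc k] = matprod (?f k) [1..<k] ** pair_transfer d D False"
      using that by (simp add: matprod_append)
    also have "matprod (?f k) [1..<k] = matprod (\<lambda>_. pair_transfer d D True) [1..<k]"
      by (rule matprod_cong) (simp add: nat_dvd_not_less)
    finally show ?thesis
      using contr[of "[1..<k]" i] that by (simp add: matrix_vector_mul_assoc)
  qed
  have nn: "0 \<le> matprod (?f k) js $ i $ j" for k js i j
    by (rule matprod_nonneg) (rule pair_transfer_nonneg)
  have chain: "(matprod (?f k) [1..<Suc (k * m)] *v ?v) $ i \<le> q ^ m * ?v $ i" if "k \<ge> 2" for k m i
  proof (induction m arbitrary: i)
    case (Suc m)
    let ?A = "matprod (?f k) [1..<Suc (k * m)]" and ?B = "matprod (?f k) [1..<Suc k]"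
    have "matprod (?f k) [1..<Suc (k * Suc m)] = ?A ** ?B"
      unfolding upt_Suc_mult matprod_append matprod_map by (simp add: dvd_add_left_iff)
    then have "(matprod (?f k) [1..<Suc (k * Suc m)] *v ?v) $ i = (?A *v (?B *v ?v)) $ i"
      by (simp add: matrix_vector_mul_assoc)
    also have "\<dots> \<le> (?A *v (q *s ?v)) $ i"
      using block[OF that] by (intro matrix_vector_mono nn) simp
    also have "\<dots> = q * (?A *v ?v) $ i"
      by (simp add: vector_scalar_commute del: upt_Suc)
    also have "\<dots> \<le> q * (q ^ m * ?v $ i)"
      using Suc q by (intro mult_left_mono) auto
    finally show ?case
      by (simp add: mult.assoc)
  qed simp
  show ?thesis
  proof (rule that[OF q])
    fix k m :: nat assume k: "k \<ge> 2"
    have D0: "D > 0" using D by simp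
    have "q ^ m \<le> 1" using q by (simp add: power_le_one)
    note bounds = trace_bounds_2[OF D0 this nn chain[OF k]]
    show "trace (matprod (?f k) [1..<Suc (k * m)]) \<le> 2 * q ^ m"
      by (rule bounds(1))
    show "trace (matprod (?f k) [1..<Suc (k * m)]) \<le> 1 + gap d D ^ (k * m) - (1 - q)\<^sup>2" if "m > 0"
    proof -
      have "q ^ m \<le> q"
        using q that power_decreasing[of 1 m q] by simp
      then have "(1 - q)\<^sup>2 \<le> (1 - q ^ m)\<^sup>2"
        using q by (intro power_mono) auto
      \<comment> \<open>Both kinds of matrix have determinant \<open>gap d D\<close>, so this power
        is the one in the second moment of the norm and cancels in the comparison.\<close>
      moreover have "det (matprod (?f k) [1..<Suc (k * m)]) = gap d D ^ (k * m)"
        by (simp add: det_matprod det_pair_transfer map_replicate_const del: upt_Suc)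
      ultimately show ?thesis
        using bounds(2) by (simp add: det_one_minus_2 del: upt_Suc)
    qed
  qed
qed

end

section \<open>Expectations of norm and purity\<close>

text \<open>The columns are the identity pairing and the crossed pairing of the bond indices. They
  span a space containing the range of the averaged one-site tensor, whose rank is thus at most
  two.\<close>

definition pairing :: "real^2^(('b::finite \<times> 'b) \<times> ('b \<times> 'b))" where
  "pairing = (\<chi> p k. if k = 1
     then of_bool (fst (fst p) = fst (snd p)) * of_bool (snd (fst p) = snd (snd p))
     else of_bool (fst (fst p) = snd (snd p)) * of_bool (snd (fst p) = fst (snd p)))"

text \<open>The quotients are Weingarten coefficients with \<open>N\<close> the dimension of the
  unitary group. The prefactors count the pairs of physical labels compatible with a row pairing:
  \<open>d\<^sup>2\<close> if it agrees with the pairing at the site, \<open>d\<close>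
  otherwise.\<close>

definition dual_pairing :: "real \<Rightarrow> real \<Rightarrow> bool \<Rightarrow> real^(('b::finite \<times> 'b) \<times> ('b \<times> 'b))^2" where
  "dual_pairing d N s = (\<chi> k q. if k = 1
     then (if s then d\<^sup>2 else d) * ((pairing $ q $ 1 - pairing $ q $ 2 / N) / (N\<^sup>2 - 1))
     else (if s then d else d\<^sup>2) * ((pairing $ q $ 2 - pairing $ q $ 1 / N) / (N\<^sup>2 - 1)))"

lemma sum_of_bool_eq [simp]:
  fixes f :: "'a::finite \<Rightarrow> 'c::semiring_1"
  shows "(\<Sum>x\<in>UNIV. f x * of_bool (x = a)) = f a" "(\<Sum>x\<in>UNIV. f x * of_bool (a = x)) = f a"
    "(\<Sum>x\<in>UNIV. of_bool (x = a) * f x) = f a" "(\<Sum>x\<in>UNIV. of_bool (a = x) * f x) = f a"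
    "(\<Sum>x::'a\<in>UNIV. of_bool (x = a)) = (1::'c)" "(\<Sum>x::'a\<in>UNIV. of_bool (a = x)) = (1::'c)"
  by (simp_all add: of_bool_def if_distrib[of "\<lambda>x. x * _"] if_distrib[of "\<lambda>x. _ * x"] cong: if_cong)

lemma pairing_inner:
  defines "D \<equiv> real CARD('b)"
  shows "(\<Sum>q\<in>UNIV. (pairing :: real^2^(('b::finite \<times> 'b) \<times> ('b \<times> 'b))) $ q $ k * pairing $ q $ l)
    = (if k = l then D\<^sup>2 else D)"
  using exhaust_2[of k] exhaust_2[of l]
  by (auto simp: pairing_def sum_UNIV_prod D_def power2_eq_square mult_ac sum_distrib_left[symmetric])

text \<open>The Weingarten coefficients are contracted with the Gram matrix of the two pairings,
  whose entries \<open>D\<^sup>2\<close> and \<open>D\<close> count free bond indices.\<close>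

lemma dual_pairing_mult_pairing:
  fixes d :: real
  defines "D \<equiv> real CARD('b::finite)"
  assumes "d \<ge> 2" "D \<ge> 2"
  shows "dual_pairing d (d * D) s ** (pairing :: real^2^(('b \<times> 'b) \<times> ('b \<times> 'b))) = pair_transfer d D s"
proof -
  define K where "K = (d * D)\<^sup>2 - 1"
  have K: "K > 0" using K_pos[OF assms(2,3)] by (simp add: K_def)
  note inner = pairing_inner[where ?'b = 'b, folded D_def]
  let ?R = "pairing :: real^2^(('b \<times> 'b) \<times> ('b \<times> 'b))"
  have lin: "(\<Sum>q\<in>UNIV. c * ((?R $ q $ i - ?R $ q $ j / N) / K) * ?R $ q $ l)
      = c / K * ((\<Sum>q\<in>UNIV. ?R $ q $ i * ?R $ q $ l) - (\<Sum>q\<in>UNIV. ?R $ q $ j * ?R $ q $ l) / N)"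
    for c i j l N
    unfolding sum_divide_distrib sum_subtractf[symmetric] sum_distrib_left
    by (intro sum.cong refl) (simp add: left_diff_distrib)
  have "(dual_pairing d (d * D) s ** ?R) $ k $ l
    = (if k = 1 then (if s then d\<^sup>2 else d) / K * ((if 1 = l then D\<^sup>2 else D) - (if 2 = l then D\<^sup>2 else D) / (d * D))
       else (if s then d else d\<^sup>2) / K * ((if 2 = l then D\<^sup>2 else D) - (if 1 = l then D\<^sup>2 else D) / (d * D)))"
    for k l
    unfolding matrix_matrix_mult_def dual_pairing_def K_def[symmetric] vec_lambda_beta
    by (cases "k = 1") (simp_all only: if_True if_False simp_thms lin inner)
  then show ?thesis
    using K assms unfolding vec_eq_iff forall_2 pair_transfer_def Let_def K_def[symmetric]
    by (cases s) (simp_all add: field_simps power2_eq_square)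
qed

section \<open>Cyclic rearrangement of traces\<close>

lemma trace_mult_commute: "trace ((A :: 'a::comm_semiring_1^'k^'n) ** B) = trace (B ** A)"
  unfolding trace_def matrix_matrix_mult_def
  by (simp add: mult.commute) (rule sum.swap)

text \<open>Moving one factor \<open>R\<close> around the trace reduces products on the large bond
  space to products of small matrices. For the empty list the two traces would be the two
  dimensions.\<close>

lemma trace_matprod_cyclic:
  fixes R :: "'a::comm_semiring_1^'k^'n"
  assumes "js \<noteq> []"
  shows "trace (matprod (\<lambda>j. R ** C j) js) = trace (matprod (\<lambda>j. C j ** R) js)"
proof -
  have push: "matprod (\<lambda>j. R ** C j) js ** R = R ** matprod (\<lambda>j. C j ** R) js" for js
  proof (induction js)
    case (Cons j js)
    have "matprod (\<lambda>j. R ** C j) (j # js) ** R = R ** C j ** (matprod (\<lambda>j. R ** C j) js ** R)"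
      by (simp add: matrix_mul_assoc)
    then show ?case
      by (simp add: Cons.IH matrix_mul_assoc)
  qed simp
  obtain j js' where js: "js = j # js'"
    using assms by (cases js) auto
  have "trace (matprod (\<lambda>j. R ** C j) js) = trace (R ** (C j ** matprod (\<lambda>j. R ** C j) js'))"
    by (simp add: js matrix_mul_assoc)
  also have "\<dots> = trace (C j ** (matprod (\<lambda>j. R ** C j) js' ** R))"
    by (subst trace_mult_commute) (simp add: matrix_mul_assoc)
  also have "\<dots> = trace (matprod (\<lambda>j. C j ** R) js)"
    unfolding push by (simp add: js matrix_mul_assoc)
  finally show ?thesis .
qed

definition complex_matrix :: "real^'n^'m \<Rightarrow> complex^'n^'m" where
  "complex_matrix A = (\<chi> i j. complex_of_real (A $ i $ j))"

lemma matprod_complex_matrix: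
  "matprod (\<lambda>j. complex_matrix (f j)) js = complex_matrix (matprod f js)"
  by (induction js) (simp_all add: complex_matrix_def vec_eq_iff mat_def matrix_matrix_mult_def)

lemma trace_complex_matrix: "trace (complex_matrix A) = of_real (trace A)"
  by (simp add: trace_def complex_matrix_def)

text \<open>Inserting the squared norm of a column, which is 1, makes this a sum of second
  moments.\<close>

lemma haar_first_moment:
  fixes \<mu> :: "(complex^'m^'m) measure"
  assumes \<mu>: "haar_unitary \<mu>" and card: "CARD('m) \<ge> 2"
  shows "(\<integral>W. W $ p $ x * cnj (W $ r $ z) \<partial>\<mu>)
    = of_bool (p = r) * of_bool (x = z) / of_nat CARD('m)"
proof -
  define N where "N = (of_nat CARD('m) :: complex)"
  have "N\<^sup>2 \<noteq> 1"
    unfolding N_def of_nat_power[symmetric] of_nat_eq_1_iff using card by simp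
  then have N: "N \<noteq> 0" "N\<^sup>2 - 1 \<noteq> 0"
    by (simp add: N_def, simp only: right_minus_eq not_False_eq_True)
  have "(\<integral>W. W $ p $ x * cnj (W $ r $ z) \<partial>\<mu>)
    = (\<integral>W. (\<Sum>t\<in>UNIV. W $ p $ x * W $ t $ x * cnj (W $ r $ z) * cnj (W $ t $ x)) \<partial>\<mu>)"
  proof (rule Bochner_Integration.integral_cong[OF refl])
    fix W assume "W \<in> space \<mu>"
    then have "(\<Sum>t\<in>UNIV. W $ t $ x * cnj (W $ t $ x)) = 1"
      using unitary_group_columns[of W x x] haar_unitary_space[OF \<mu>] by simp
    then have "W $ p $ x * cnj (W $ r $ z)
        = W $ p $ x * cnj (W $ r $ z) * (\<Sum>t\<in>UNIV. W $ t $ x * cnj (W $ t $ x))"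
      by simp
    also have "\<dots> = (\<Sum>t\<in>UNIV. W $ p $ x * W $ t $ x * cnj (W $ r $ z) * cnj (W $ t $ x))"
      unfolding sum_distrib_left by (simp only: mult_ac)
    finally show "W $ p $ x * cnj (W $ r $ z)
        = (\<Sum>t\<in>UNIV. W $ p $ x * W $ t $ x * cnj (W $ r $ z) * cnj (W $ t $ x))" .
  qed
  also have "\<dots> = (\<Sum>t\<in>UNIV. haar_moment \<mu> x x z x p t r t)"
    unfolding haar_moment_def
    by (rule Bochner_Integration.integral_sum) (rule haar_moment_integrable[OF \<mu>])
  also have "\<dots> = of_bool (p = r) * of_bool (x = z) * ((1 - 1 / N) / (N\<^sup>2 - 1) * (N + 1))"
  proof -
    define g where "g = (1 - 1 / N) / (N\<^sup>2 - 1)"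
    define G where "G = of_bool (x = z) * g"
    have G: "(of_bool (x = z) * of_bool (x = x) - of_bool (x = x) * of_bool (x = z) / N) / (N\<^sup>2 - 1) = G"
      "(of_bool (x = x) * of_bool (x = z) - of_bool (x = z) * of_bool (x = x) / N) / (N\<^sup>2 - 1) = G"
      by (simp_all add: G_def g_def)
    have "(\<Sum>t\<in>UNIV. haar_moment \<mu> x x z x p t r t)
        = G * (N * of_bool (p = r)) + G * of_bool (p = r)"
      unfolding haar_moment_eq[OF \<mu> card, folded N_def] sum.distrib sum_distrib_left[symmetric] G
      by (simp add: N_def)
    then show ?thesis
      unfolding g_def[symmetric] by (simp add: G_def distrib_left mult_ac)
  qed
  also have "(1 - 1 / N) / (N\<^sup>2 - 1) * (N + 1) = 1 / N"
  proof -
    have "(1 - 1 / N) * (N + 1) = (N\<^sup>2 - 1) / N"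
      using N(1) by (simp add: field_simps power2_eq_square)
    then show ?thesis
      using N(2) by simp
  qed
  finally show ?thesis
    by (simp add: N_def)
qed

section \<open>One-site tensors: entries, bounds and averages\<close>

lemma site_entry:
  "site e0 s W $ p $ q = (\<Sum>i\<in>UNIV. \<Sum>i'\<in>UNIV.
     W $ (i, fst (fst p)) $ (e0, fst (fst q)) * W $ (i', snd (fst p)) $ (e0, snd (fst q))
     * cnj (W $ (if s then i else i', fst (snd p)) $ (e0, fst (snd q)))
     * cnj (W $ (if s then i' else i, snd (snd p)) $ (e0, snd (snd q))))"
  by (simp add: site_def kron_def mps_matrix_def cnj_matrix_def mult.assoc)

lemma site1_entry:
  "site1 e0 W $ p $ q = (\<Sum>i\<in>UNIV.
     W $ (i, snd p) $ (e0, snd q) * cnj (W $ (i, fst p) $ (e0, fst q)))"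
  by (simp add: site1_def kron_def mps_matrix_def cnj_matrix_def mult.commute)

lemma site_measurable:
  assumes "haar_unitary \<mu>"
  shows "(\<lambda>W. site e0 s W $ p $ q) \<in> borel_measurable \<mu>"
  unfolding site_entry
  by (intro borel_measurable_sum borel_measurable_integrable haar_moment_integrable assms)

lemma haar_first_moment_integrable:
  assumes "haar_unitary \<mu>"
  shows "integrable \<mu> (\<lambda>W. W $ p $ x * cnj (W $ r $ z))"
  using assms
  by (intro haar_unitary_integrable[where B = 1] borel_measurable_times
      measurable_cnj
      haar_unitary_measurable_entry norm_mult_le_one)
    (auto simp: unitary_group_entry_le)

lemma site1_measurable:
  assumes "haar_unitary \<mu>"
  shows "(\<lambda>W. site1 e0 W $ p $ q) \<in> borel_measurable \<mu>"
  unfolding site1_entry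
  by (intro borel_measurable_sum borel_measurable_integrable haar_first_moment_integrable assms)

lemma site_bound:
  fixes W :: "complex^('d::finite \<times> 'b::finite)^('d \<times> 'b)"
  assumes "W \<in> unitary_group"
  shows "norm (site e0 s W $ p $ q) \<le> real CARD('d) * real CARD('d)"
proof -
  have "norm (site e0 s W $ p $ q) \<le> (\<Sum>i::'d\<in>UNIV. \<Sum>i'::'d\<in>UNIV. 1)"
    unfolding site_entry
    by (intro sum_norm_le norm_mult_le_one) (simp_all add: unitary_group_entry_le[OF assms])
  then show ?thesis by simp
qed

lemma site1_bound:
  fixes W :: "complex^('d::finite \<times> 'b::finite)^('d \<times> 'b)"
  assumes "W \<in> unitary_group"
  shows "norm (site1 e0 W $ p $ q) \<le> real CARD('d)"
proof -
  have "norm (site1 e0 W $ p $ q) \<le> (\<Sum>i::'d\<in>UNIV. 1)"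
    unfolding site1_entry
    by (intro sum_norm_le norm_mult_le_one) (simp_all add: unitary_group_entry_le[OF assms])
  then show ?thesis by simp
qed

lemma site_expectation:
  fixes \<mu> :: "(complex^('d::finite \<times> 'b::finite)^('d \<times> 'b)) measure"
  assumes \<mu>: "haar_unitary \<mu>" and card: "CARD('d \<times> 'b) \<ge> 2"
  shows "(\<integral>W. site e0 s W $ p $ q \<partial>\<mu>)
    = of_real ((pairing ** dual_pairing (real CARD('d)) (real CARD('d) * real CARD('b)) s) $ p $ q)"
proof -
  define N where "N = (of_nat CARD('d \<times> 'b) :: complex)"
  define \<alpha> where "\<alpha> = (of_real (pairing $ q $ 1) - of_real (pairing $ q $ 2) / N) / (N\<^sup>2 - 1)"
  define \<beta> where "\<beta> = (of_real (pairing $ q $ 2) - of_real (pairing $ q $ 1) / N) / (N\<^sup>2 - 1)"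
  have "(\<integral>W. site e0 s W $ p $ q \<partial>\<mu>) = (\<Sum>i\<in>UNIV. \<Sum>i'\<in>UNIV.
     haar_moment \<mu> (e0, fst (fst q)) (e0, snd (fst q)) (e0, fst (snd q)) (e0, snd (snd q))
      (i, fst (fst p)) (i', snd (fst p)) (if s then i else i', fst (snd p)) (if s then i' else i, snd (snd p)))"
    unfolding site_entry haar_moment_def
    by (simp only: Bochner_Integration.integral_sum
        Bochner_Integration.integrable_sum haar_moment_integrable[OF \<mu>] simp_thms)
  \<comment> \<open>A row pairing demands equal bond indices, which is an entry of
    \<open>pairing\<close>, and equal physical labels. The latter agree always if the pairing is the
    one selected by \<open>s\<close>, and only for \<open>i = i'\<close> otherwise.\<close>
  also have "\<dots> = (\<Sum>i::'d\<in>UNIV. \<Sum>i'::'d\<in>UNIV.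
      \<alpha> * of_real (pairing $ p $ 1) * (if s then 1 else of_bool (i = i')) +
      \<beta> * of_real (pairing $ p $ 2) * (if s then of_bool (i = i') else 1))"
    unfolding haar_moment_eq[OF \<mu> card, folded N_def] \<alpha>_def \<beta>_def pairing_def
    by (intro sum.cong refl) (cases s; auto)
  also have "\<dots> = \<alpha> * of_real (pairing $ p $ 1) * (if s then of_nat CARD('d) ^ 2 else of_nat CARD('d))
      + \<beta> * of_real (pairing $ p $ 2) * (if s then of_nat CARD('d) else of_nat CARD('d) ^ 2)"
    by (cases s) (simp_all add: sum.distrib sum_distrib_left[symmetric] power2_eq_square distrib_left mult_ac)
  also have "\<dots> = of_real ((pairing ** dual_pairing (real CARD('d)) (real CARD('d) * real CARD('b)) s) $ p $ q)"
    by (simp add: matrix_matrix_mult_def sum_2 dual_pairing_def \<alpha>_def \<beta>_def N_def mult_ac)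
  finally show ?thesis .
qed

text \<open>The average has rank one; the index type \<open>1\<close> puts it into the form to which
  the cyclic rearrangement applies.\<close>

lemma site1_expectation:
  fixes \<mu> :: "(complex^('d::finite \<times> 'b::finite)^('d \<times> 'b)) measure"
  assumes \<mu>: "haar_unitary \<mu>" and card: "CARD('d \<times> 'b) \<ge> 2"
  shows "(\<integral>W. site1 e0 W $ p $ q \<partial>\<mu>)
    = of_real (((\<chi> p k. of_bool (fst p = snd p)) ** (\<chi> (k::1) q. of_bool (fst q = snd q) / real CARD('b))) $ p $ q)"
proof -
  have "(\<integral>W. site1 e0 W $ p $ q \<partial>\<mu>) = (\<Sum>i\<in>UNIV. \<integral>W. W $ (i, snd p) $ (e0, snd q) * cnj (W $ (i, fst p) $ (e0, fst q)) \<partial>\<mu>)"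
    unfolding site1_entry
    by (rule Bochner_Integration.integral_sum) (rule haar_first_moment_integrable[OF \<mu>])
  then show ?thesis
    unfolding haar_first_moment[OF \<mu> card]
    by (simp add: matrix_matrix_mult_def sum_1 eq_commute[of "snd p"] eq_commute[of "snd q"])
qed

section \<open>Integrals of matrix products over independent sites\<close>

lemma matprod_measurable:
  fixes F :: "nat \<Rightarrow> 'w \<Rightarrow> complex^'n^'n"
  assumes "\<And>j p q. j \<in> set js \<Longrightarrow> (\<lambda>W. F j W $ p $ q) \<in> borel_measurable \<mu>" "set js \<subseteq> I"
  shows "(\<lambda>U. matprod (\<lambda>j. F j (U j)) js $ p $ q) \<in> borel_measurable (Pi\<^sub>M I (\<lambda>_. \<mu>))"
  using assms
proof (induction js arbitrary: p q)
  case (Cons j js)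
  have "(\<lambda>U. F j (U j) $ p $ r) \<in> borel_measurable (Pi\<^sub>M I (\<lambda>_. \<mu>))" for r
    by (rule measurable_compose[OF measurable_component_singleton]) (use Cons.prems in auto)
  then show ?case
    using Cons by (simp add: matrix_matrix_mult_def)
qed simp

lemma matprod_integrable:
  fixes F :: "nat \<Rightarrow> 'w \<Rightarrow> complex^'n^'n"
  assumes "prob_space \<mu>"
    and "\<And>j p q. j \<in> set js \<Longrightarrow> (\<lambda>W. F j W $ p $ q) \<in> borel_measurable \<mu>"
    and "\<And>j W p q. j \<in> set js \<Longrightarrow> W \<in> space \<mu> \<Longrightarrow> norm (F j W $ p $ q) \<le> K" "K \<ge> 0"
    and "set js \<subseteq> I"
  shows "integrable (Pi\<^sub>M I (\<lambda>_. \<mu>)) (\<lambda>U. matprod (\<lambda>j. F j (U j)) js $ p $ q)"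
proof -
  interpret prob_space "Pi\<^sub>M I (\<lambda>_. \<mu>)"
    by (intro prob_space_PiM assms)
  show ?thesis
  proof (rule integrable_const_bound)
    show "AE U in Pi\<^sub>M I (\<lambda>_. \<mu>). norm (matprod (\<lambda>j. F j (U j)) js $ p $ q) \<le> (real CARD('n) * K) ^ length js"
    proof (rule AE_I2)
      fix U assume "U \<in> space (Pi\<^sub>M I (\<lambda>_. \<mu>))"
      then have "U j \<in> space \<mu>" if "j \<in> set js" for j
        using that assms(5) by (auto simp: space_PiM)
      then show "norm (matprod (\<lambda>j. F j (U j)) js $ p $ q) \<le> (real CARD('n) * K) ^ length js"
        using assms(3,4) by (intro norm_matprod_le) auto
    qed
  qed (rule matprod_measurable[OF assms(2,5)])
qed

text \<open>The sites are distinct, hence the factors depend on different coordinates of the product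
  measure, and Fubini splits them off one by one.\<close>

lemma integral_matprod:
  fixes F :: "nat \<Rightarrow> 'w \<Rightarrow> complex^'n^'n"
  assumes prob: "prob_space \<mu>"
    and meas: "\<And>j p q. j \<in> set js \<Longrightarrow> (\<lambda>W. F j W $ p $ q) \<in> borel_measurable \<mu>"
    and bound: "\<And>j W p q. j \<in> set js \<Longrightarrow> W \<in> space \<mu> \<Longrightarrow> norm (F j W $ p $ q) \<le> K" "K \<ge> 0"
    and "distinct js"
  shows "(\<integral>U. matprod (\<lambda>j. F j (U j)) js $ p $ q \<partial>Pi\<^sub>M (set js) (\<lambda>_. \<mu>))
    = matprod (\<lambda>j. \<chi> p q. \<integral>W. F j W $ p $ q \<partial>\<mu>) js $ p $ q"
  using \<open>distinct js\<close> meas bound(1)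
proof (induction js arbitrary: p)
  case Nil
  interpret prob_space "Pi\<^sub>M {} (\<lambda>_. \<mu>) :: (nat \<Rightarrow> 'w) measure"
    by (rule prob_space_PiM) simp
  show ?case by (simp add: prob_space)
next
  case (Cons j js)
  interpret prob_space \<mu> by (rule prob)
  interpret product_sigma_finite "\<lambda>_::nat. \<mu>" ..
  let ?P = "Pi\<^sub>M (set js) (\<lambda>_. \<mu>)"
  have int: "integrable (Pi\<^sub>M (insert j (set js)) (\<lambda>_. \<mu>)) (\<lambda>U. matprod (\<lambda>j. F j (U j)) (j # js) $ p $ q)"
    using Cons.prems bound(2) by (intro matprod_integrable[where K = K] prob) auto
  have int_js: "integrable ?P (\<lambda>U. matprod (\<lambda>j. F j (U j)) js $ r $ q)" for r
    using Cons.prems bound(2) by (intro matprod_integrable[where K = K] prob) auto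
  have int_j: "integrable \<mu> (\<lambda>W. F j W $ p $ r)" for r
    using Cons.prems by (intro integrable_const_bound[where B = K]) auto
  have upd: "matprod (\<lambda>i. F i ((U(j := W)) i)) js = matprod (\<lambda>i. F i (U i)) js" for U W
    using Cons.prems by (intro matprod_cong) auto
  have "(\<integral>U. matprod (\<lambda>j. F j (U j)) (j # js) $ p $ q \<partial>Pi\<^sub>M (set (j # js)) (\<lambda>_. \<mu>))
    = (\<integral>U. (\<integral>W. matprod (\<lambda>i. F i ((U(j := W)) i)) (j # js) $ p $ q \<partial>\<mu>) \<partial>?P)"
    using Cons.prems int by (simp only: list.set) (rule product_integral_insert, auto)
  also have "\<dots> = (\<integral>U. (\<integral>W. (\<Sum>r\<in>UNIV. F j W $ p $ r * matprod (\<lambda>i. F i (U i)) js $ r $ q) \<partial>\<mu>) \<partial>?P)"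
    unfolding matprod_simps upd by (simp add: matrix_matrix_mult_def)
  also have "\<dots> = (\<integral>U. (\<Sum>r\<in>UNIV. (\<integral>W. F j W $ p $ r \<partial>\<mu>) * matprod (\<lambda>i. F i (U i)) js $ r $ q) \<partial>?P)"
    using int_j by simp
  also have "\<dots> = (\<Sum>r\<in>UNIV. (\<integral>W. F j W $ p $ r \<partial>\<mu>) * (\<integral>U. matprod (\<lambda>i. F i (U i)) js $ r $ q \<partial>?P))"
    using int_js by simp
  also have "\<dots> = (\<Sum>r\<in>UNIV. (\<integral>W. F j W $ p $ r \<partial>\<mu>) * matprod (\<lambda>j. \<chi> p q. \<integral>W. F j W $ p $ q \<partial>\<mu>) js $ r $ q)"
    using Cons by simp
  finally show ?case
    by (simp add: matrix_matrix_mult_def)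
qed

section \<open>Expectations for the random matrix product state\<close>

context
  fixes \<mu> :: "(complex^('d::finite \<times> 'b::finite)^('d \<times> 'b)) measure" and e0 :: 'd
  assumes \<mu>: "haar_unitary \<mu>" and d: "CARD('d) \<ge> 2" and D: "CARD('b) \<ge> 2"
begin

lemma prob_space_haar: "prob_space \<mu>"
  using \<mu> by (simp add: haar_unitary_def)

lemma card_ge_2: "CARD('d \<times> 'b) \<ge> 2"
proof -
  have "2 * 1 \<le> CARD('d) * CARD('b)"
    using d D by (intro mult_mono) auto
  then show ?thesis by simp
qed

lemma site_norm: "W \<in> space \<mu> \<Longrightarrow> norm (site e0 s W $ p $ q) \<le> real CARD('d) * real CARD('d)"
  using site_bound[of W] haar_unitary_space[OF \<mu>] by simp

lemma site1_norm: "W \<in> space \<mu> \<Longrightarrow> norm (site1 e0 W $ p $ q) \<le> real CARD('d)"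
  using site1_bound[of W] haar_unitary_space[OF \<mu>] by simp

lemma purity_integrable:
  "integrable (Pi\<^sub>M {1..n} (\<lambda>_. \<mu>)) (\<lambda>U. purity {1..n} A (mps e0 n U))"
  unfolding purity_mps trace_def
  by (intro Bochner_Integration.integrable_sum matprod_integrable[where K = "real CARD('d) * real CARD('d)"]
      site_measurable site_norm prob_space_haar \<mu>) auto

lemma norm_square_integrable:
  "integrable (Pi\<^sub>M {1..n} (\<lambda>_. \<mu>)) (\<lambda>U. norm_square {1..n} (mps e0 n U))"
  unfolding norm_square_mps trace_def
  by (intro Bochner_Integration.integrable_sum matprod_integrable[where K = "real CARD('d)"]
      site1_measurable site1_norm prob_space_haar \<mu>) auto

lemma purity_expectation:
  assumes "n > 0"
  shows "(\<integral>U. purity {1..n} A (mps e0 n U) \<partial>Pi\<^sub>M {1..n} (\<lambda>_. \<mu>))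
    = of_real (trace (matprod (\<lambda>j. pair_transfer (real CARD('d)) (real CARD('b)) (j \<in> A)) [1..<Suc n]))"
proof -
  let ?d = "real CARD('d)" and ?D = "real CARD('b)" and ?js = "[1..<Suc n]"
  let ?T = "\<lambda>j. pairing ** dual_pairing ?d (?d * ?D) (j \<in> A)
    :: real^(('b \<times> 'b) \<times> ('b \<times> 'b))^(('b \<times> 'b) \<times> ('b \<times> 'b))"
  have E: "(\<chi> p q. \<integral>W. site e0 (j \<in> A) W $ p $ q \<partial>\<mu>) = complex_matrix (?T j)" for j
    by (simp add: site_expectation[OF \<mu> card_ge_2] complex_matrix_def)
  have "(\<integral>U. purity {1..n} A (mps e0 n U) \<partial>Pi\<^sub>M {1..n} (\<lambda>_. \<mu>))
    = (\<Sum>p\<in>UNIV. \<integral>U. matprod (\<lambda>j. site e0 (j \<in> A) (U j)) ?js $ p $ p \<partial>Pi\<^sub>M {1..n} (\<lambda>_. \<mu>))"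
    unfolding purity_mps trace_def
    by (intro Bochner_Integration.integral_sum matprod_integrable[where K = "?d * ?d"]
        site_measurable site_norm prob_space_haar \<mu>) auto
  also have "\<dots> = (\<Sum>p\<in>UNIV. matprod (\<lambda>j. \<chi> p q. \<integral>W. site e0 (j \<in> A) W $ p $ q \<partial>\<mu>) ?js $ p $ p)"
    unfolding set_sites
    by (intro sum.cong refl integral_matprod[where K = "?d * ?d"] site_measurable site_norm prob_space_haar \<mu>) auto
  also have "\<dots> = of_real (trace (matprod ?T ?js))"
    unfolding E matprod_complex_matrix trace_def[symmetric] trace_complex_matrix ..
  also have "trace (matprod ?T ?js) = trace (matprod (\<lambda>j. dual_pairing ?d (?d * ?D) (j \<in> A) **
      (pairing :: real^2^(('b \<times> 'b) \<times> ('b \<times> 'b)))) ?js)"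
    by (rule trace_matprod_cyclic) (use assms in simp)
  also have "\<dots> = trace (matprod (\<lambda>j. pair_transfer ?d ?D (j \<in> A)) ?js)"
    using d D by (subst dual_pairing_mult_pairing) simp_all
  finally show ?thesis .
qed

lemma norm_square_expectation:
  assumes "n > 0"
  shows "(\<integral>U. norm_square {1..n} (mps e0 n U) \<partial>Pi\<^sub>M {1..n} (\<lambda>_. \<mu>)) = 1"
proof -
  let ?d = "real CARD('d)" and ?js = "[1..<Suc n]"
  let ?R = "\<chi> p k. of_bool (fst p = snd p) :: real^1^('b \<times> 'b)"
  let ?C = "\<chi> k q. of_bool (fst q = snd q) / real CARD('b) :: real^('b \<times> 'b)^1"
  have E: "(\<chi> p q. \<integral>W. site1 e0 W $ p $ q \<partial>\<mu>) = complex_matrix (?R ** ?C)"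
    by (simp add: site1_expectation[OF \<mu> card_ge_2] complex_matrix_def)
  have CR: "?C ** ?R = mat 1"
    using D by (simp add: vec_eq_iff matrix_matrix_mult_def mat_def sum_UNIV_prod sum_divide_distrib[symmetric])
  have mat_1: "matprod (\<lambda>_. mat 1) js = (mat 1 :: real^1^1)" for js :: "nat list"
    by (induction js) simp_all
  have one: "trace (matprod (\<lambda>_. ?C ** ?R) ?js) = 1"
    unfolding CR mat_1 by (simp add: trace_def mat_def)
  have "(\<integral>U. norm_square {1..n} (mps e0 n U) \<partial>Pi\<^sub>M {1..n} (\<lambda>_. \<mu>))
    = (\<Sum>p\<in>UNIV. \<integral>U. matprod (\<lambda>j. site1 e0 (U j)) ?js $ p $ p \<partial>Pi\<^sub>M {1..n} (\<lambda>_. \<mu>))"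
    unfolding norm_square_mps trace_def
    by (intro Bochner_Integration.integral_sum matprod_integrable[where K = ?d]
        site1_measurable site1_norm prob_space_haar \<mu>) auto
  also have "\<dots> = (\<Sum>p\<in>UNIV. matprod (\<lambda>j. \<chi> p q. \<integral>W. site1 e0 W $ p $ q \<partial>\<mu>) ?js $ p $ p)"
    unfolding set_sites
    by (intro sum.cong refl integral_matprod[where K = ?d] site1_measurable site1_norm prob_space_haar \<mu>) auto
  also have "\<dots> = of_real (trace (matprod (\<lambda>_. ?R ** ?C) ?js))"
    unfolding E matprod_complex_matrix trace_def[symmetric] trace_complex_matrix ..
  also have "trace (matprod (\<lambda>_. ?R ** ?C) ?js) = trace (matprod (\<lambda>_. ?C ** ?R) ?js)"
    by (rule trace_matprod_cyclic) (use assms in simp)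
  finally show ?thesis
    unfolding one by simp
qed

end

section \<open>Tail bounds\<close>

text \<open>Unless \<open>N\<close> is at least 1/2 away from its mean or \<open>X\<close> is at
  least \<open>exp (- t) / 4\<close>, the quotient is at most \<open>exp (- t)\<close>. Chebyshev's
  and Markov's inequalities bound the two exceptional events.\<close>

lemma (in prob_space) entropy_tail_concentrated:
  fixes N X :: "'a \<Rightarrow> real"
  assumes int: "integrable M N" "integrable M (\<lambda>\<omega>. (N \<omega>)\<^sup>2)" "integrable M X"
    and N: "expectation N = 1" "expectation (\<lambda>\<omega>. (N \<omega>)\<^sup>2) \<le> 1 + l"
    and X: "expectation X \<le> b" "\<And>\<omega>. X \<omega> \<ge> 0" "\<And>\<omega>. N \<omega> \<noteq> 0 \<Longrightarrow> X \<omega> > 0"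
  shows "prob {\<omega>\<in>space M. t \<le> - ln (X \<omega> / (N \<omega>)\<^sup>2)} \<ge> 1 - (4 * l + 4 * b * exp t)"
proof -
  note [measurable] = borel_measurable_integrable[OF int(1)] borel_measurable_integrable[OF int(3)]
  let ?E = "{\<omega>\<in>space M. t \<le> - ln (X \<omega> / (N \<omega>)\<^sup>2)}"
  let ?F = "{\<omega>\<in>space M. 1 / 4 \<le> (N \<omega> - 1)\<^sup>2}" and ?G = "{\<omega>\<in>space M. exp (- t) / 4 \<le> X \<omega>}"
  have sq: "(\<lambda>\<omega>. (N \<omega> - 1)\<^sup>2) = (\<lambda>\<omega>. (N \<omega>)\<^sup>2 - 2 * N \<omega> + 1)"
    by (simp add: power2_diff algebra_simps)
  have int_sq: "integrable M (\<lambda>\<omega>. (N \<omega> - 1)\<^sup>2)"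
    unfolding sq using int by simp
  have "expectation (\<lambda>\<omega>. (N \<omega> - 1)\<^sup>2) \<le> l"
    unfolding sq using int N by (simp add: prob_space)
  then have F: "prob ?F \<le> 4 * l"
    using integral_Markov_inequality_measure[OF int_sq, of "{}" "1 / 4"] by simp
  have "prob ?G \<le> 4 * exp t * expectation X"
    using integral_Markov_inequality_measure[OF int(3), of "{}" "exp (- t) / 4"] X(2)
    by (simp add: exp_minus field_simps)
  also have "\<dots> \<le> 4 * exp t * b"
    using X(1) by (intro mult_left_mono) auto
  finally have G: "prob ?G \<le> 4 * b * exp t"
    by (simp add: mult_ac)
  have "\<omega> \<in> ?E \<union> (?F \<union> ?G)" if "\<omega> \<in> space M" for \<omega>
  proof (cases "\<omega> \<in> ?F \<union> ?G")
    case False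
    then have f: "(N \<omega> - 1)\<^sup>2 < (1 / 2)\<^sup>2" and g: "X \<omega> < exp (- t) / 4"
      using that by (auto simp: power2_eq_square)
    from f have "\<bar>N \<omega> - 1\<bar> < 1 / 2"
      using power2_less_imp_less[of "\<bar>N \<omega> - 1\<bar>" "1 / 2"] by simp
    then have n: "N \<omega> > 1 / 2" by linarith
    then have "(1 / 2)\<^sup>2 < (N \<omega>)\<^sup>2"
      by (intro power_strict_mono) auto
    then have "exp (- t) * (1 / 4) < exp (- t) * (N \<omega>)\<^sup>2"
      by (intro mult_strict_left_mono) (auto simp: power2_eq_square)
    with g have "X \<omega> \<le> exp (- t) * (N \<omega>)\<^sup>2"
      by linarith
    with n have "X \<omega> / (N \<omega>)\<^sup>2 \<le> exp (- t)"
      by (simp add: pos_divide_le_eq)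
    moreover have "X \<omega> / (N \<omega>)\<^sup>2 > 0"
      using X(3)[of \<omega>] n by simp
    ultimately have "ln (X \<omega> / (N \<omega>)\<^sup>2) \<le> - t"
      by (metis exp_gt_zero ln_exp ln_le_cancel_iff)
    then show ?thesis using that by simp
  qed auto
  then have "prob (space M) \<le> prob (?E \<union> (?F \<union> ?G))"
    by (intro finite_measure_mono) auto
  then have "1 \<le> prob (?E \<union> (?F \<union> ?G))"
    by (simp only: prob_space)
  also have "\<dots> \<le> prob ?E + prob (?F \<union> ?G)"
    by (intro measure_Un_le) auto
  also have "prob (?F \<union> ?G) \<le> prob ?F + prob ?G"
    by (intro measure_Un_le) auto
  finally show ?thesis
    using F G by linarith
qed

text \<open>Here nothing is small. The gap \<open>\<epsilon>\<close> between the two expectations forces \<open>X\<close> to stay below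
  \<open>(1 - \<epsilon> / 4) * N\<^sup>2\<close> on an event that carries a fixed share of \<open>N\<^sup>2\<close>; uniform integrability of
  \<open>N\<^sup>2\<close> (through \<open>a\<close> and \<open>b\<close>) bounds its probability from below.\<close>

lemma (in prob_space) entropy_tail_gap:
  fixes N X Y :: "'a \<Rightarrow> real"
  assumes int: "integrable M N" "integrable M (\<lambda>\<omega>. (N \<omega>)\<^sup>2)" "integrable M X" "integrable M Y"
    and gap: "expectation (\<lambda>\<omega>. (N \<omega>)\<^sup>2) - expectation X \<ge> \<epsilon>" "0 < \<epsilon>" "\<epsilon> < 1"
      "expectation (\<lambda>\<omega>. (N \<omega>)\<^sup>2) \<le> 2"
    and X: "\<And>\<omega>. X \<omega> \<ge> 0" "\<And>\<omega>. N \<omega> \<noteq> 0 \<Longrightarrow> X \<omega> > 0"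
    and Y: "\<And>\<omega>. \<omega> \<in> space M \<Longrightarrow> (N \<omega>)\<^sup>2 \<le> Y \<omega> + b" "\<And>\<omega>. 0 \<le> Y \<omega>" "expectation Y \<le> \<epsilon> / 4"
      "b > 0"
    and t: "t \<le> - ln (1 - \<epsilon> / 4)"
  shows "prob {\<omega>\<in>space M. t \<le> - ln (X \<omega> / (N \<omega>)\<^sup>2)} \<ge> \<epsilon> / (4 * b)"
proof -
  note [measurable] = borel_measurable_integrable[OF int(1)] borel_measurable_integrable[OF int(3)]
  let ?E = "{\<omega>\<in>space M. t \<le> - ln (X \<omega> / (N \<omega>)\<^sup>2)}"
  \<comment> \<open>Points with \<open>N \<omega> = 0\<close> are kept out: there the quotient is 0
    by convention and \<open>ln 0 = 0\<close> gives no entropy.\<close>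
  define G where "G = {\<omega>\<in>space M. N \<omega> \<noteq> 0 \<and> X \<omega> \<le> (1 - \<epsilon> / 4) * (N \<omega>)\<^sup>2}"
  have [measurable]: "G \<in> sets M"
    unfolding G_def by measurable
  have int_G: "integrable M (indicator G :: 'a \<Rightarrow> real)"
    by (simp add: integrable_indicator_iff emeasure_eq_measure)
  \<comment> \<open>On \<open>G\<close> the difference is at most
    \<open>(N \<omega>)\<^sup>2\<close>, which splits into \<open>Y \<omega>\<close>, small in
    expectation, and the constant \<open>b\<close>. Off \<open>G\<close> it is at most the share
    \<epsilon> / 4 of \<open>(N \<omega>)\<^sup>2\<close>.\<close>
  have "(N \<omega>)\<^sup>2 - X \<omega> \<le> \<epsilon> / 4 * (N \<omega>)\<^sup>2 + (Y \<omega> + b * indicator G \<omega>)" if "\<omega> \<in> space M" for \<omega>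
  proof (cases "\<omega> \<in> G")
    case True
    moreover have "0 \<le> \<epsilon> / 4 * (N \<omega>)\<^sup>2"
      using gap by simp
    ultimately show ?thesis
      using Y(1)[OF that] X(1)[of \<omega>] by simp
  next
    case False
    then have "(N \<omega>)\<^sup>2 - X \<omega> \<le> \<epsilon> / 4 * (N \<omega>)\<^sup>2"
      using that X(1)[of \<omega>] by (cases "N \<omega> = 0") (auto simp: G_def algebra_simps)
    then show ?thesis
      using Y(2)[of \<omega>] False by simp
  qed
  then have "expectation (\<lambda>\<omega>. (N \<omega>)\<^sup>2 - X \<omega>)
      \<le> expectation (\<lambda>\<omega>. \<epsilon> / 4 * (N \<omega>)\<^sup>2 + (Y \<omega> + b * indicator G \<omega>))"
    using int int_G by (intro integral_mono) auto
  also have "\<dots> = \<epsilon> / 4 * expectation (\<lambda>\<omega>. (N \<omega>)\<^sup>2) + (expectation Y + b * prob G)"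
    using int int_G by simp
  \<comment> \<open>Of the gap \<epsilon> the first term takes half and \<open>Y\<close> a quarter,
    so a quarter remains for \<open>G\<close>.\<close>
  also have "\<dots> \<le> \<epsilon> / 4 * 2 + (\<epsilon> / 4 + b * prob G)"
    using mult_left_mono[OF gap(4), of "\<epsilon> / 4"] gap(2) Y(3) by linarith
  finally have "\<epsilon> / 4 \<le> b * prob G"
    using int gap(1) by simp
  then have "\<epsilon> / (4 * b) \<le> prob G"
    using Y(4) by (simp add: field_simps)
  also have "prob G \<le> prob ?E"
  proof (rule finite_measure_mono)
    show "G \<subseteq> ?E"
    proof
      fix \<omega> assume g: "\<omega> \<in> G"
      then have "0 < X \<omega> / (N \<omega>)\<^sup>2" "X \<omega> / (N \<omega>)\<^sup>2 \<le> 1 - \<epsilon> / 4"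
        using X(2)[of \<omega>] by (auto simp: G_def divide_le_eq)
      then have "ln (X \<omega> / (N \<omega>)\<^sup>2) \<le> ln (1 - \<epsilon> / 4)"
        by simp
      then show "\<omega> \<in> ?E"
        using g t by (simp add: G_def)
    qed
  qed simp
  finally show ?thesis .
qed

section \<open>Passage to the distribution of the random state\<close>

lemma override_on_configs: "u \<in> configs S \<Longrightarrow> v \<in> configs S \<Longrightarrow> override_on v u A \<in> configs S"
  by (auto simp: configs_def override_on_def PiE_iff extensional_def)

lemma purity_restrict: "purity S A (restrict \<psi> (configs S)) = purity S A \<psi>"
  unfolding purity_def by (intro sum.cong refl) (simp add: override_on_configs)

lemma norm_square_restrict: "norm_square S (restrict \<psi> (configs S)) = norm_square S \<psi>"
  unfolding norm_square_def by (intro sum.cong refl) simp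

lemma purity_measurable:
  "purity S A \<in> borel_measurable (Pi\<^sub>M (configs S) (\<lambda>_. borel))"
  unfolding purity_def[abs_def]
  by (intro borel_measurable_sum borel_measurable_times measurable_cnj measurable_component_singleton
      override_on_configs)

lemma norm_square_measurable:
  "norm_square S \<in> borel_measurable (Pi\<^sub>M (configs S) (\<lambda>_. borel))"
  unfolding norm_square_def[abs_def]
  by (intro borel_measurable_sum borel_measurable_times measurable_cnj measurable_component_singleton)

context
  fixes \<mu> :: "(complex^('d::finite \<times> 'b::finite)^('d \<times> 'b)) measure" and e0 :: 'd
  assumes \<mu>: "haar_unitary \<mu>" and d: "CARD('d) \<ge> 2" and D: "CARD('b) \<ge> 2"
begin

lemma mps_measurable: "(\<lambda>U. mps e0 n U x) \<in> borel_measurable (Pi\<^sub>M {1..n} (\<lambda>_. \<mu>))"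
  unfolding mps_eq trace_def
  by (intro borel_measurable_sum matprod_measurable[where F = "\<lambda>j W. mps_matrix e0 W (x j)"])
    (auto simp: mps_matrix_def intro: haar_unitary_measurable_entry[OF \<mu>])

text \<open>\<open>rmps\<close> is an image measure, so the event is pulled back to the unitaries;
  restricting the amplitudes to configurations changes neither norm nor purity.\<close>

lemma rmps_entropy_prob:
  assumes "A \<subseteq> {1..n}"
  shows "\<P>(\<psi> in rmps \<mu> e0 n. t \<le> renyi2_entropy A (partial_trace {1..n} A (density_matrix {1..n} \<psi>)))
    = \<P>(U in Pi\<^sub>M {1..n} (\<lambda>_. \<mu>).
        t \<le> - ln (Re (purity {1..n} A (mps e0 n U)) / (Re (norm_square {1..n} (mps e0 n U)))\<^sup>2))"
proof -
  let ?Q = "Pi\<^sub>M (configs {1..n}) (\<lambda>_. borel) :: ((nat \<Rightarrow> 'd) \<Rightarrow> complex) measure"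
  let ?g = "\<lambda>U. restrict (mps e0 n U) (configs {1..n})"
  let ?S = "{\<psi>\<in>space ?Q. t \<le> - ln (Re (purity {1..n} A \<psi>) / (Re (norm_square {1..n} \<psi>))\<^sup>2)}"
  note [measurable] = purity_measurable norm_square_measurable
  have g: "?g \<in> measurable (Pi\<^sub>M {1..n} (\<lambda>_. \<mu>)) ?Q"
    by (intro measurable_restrict mps_measurable)
  have S: "?S \<in> sets ?Q"
    by measurable
  have "\<P>(\<psi> in rmps \<mu> e0 n. t \<le> renyi2_entropy A (partial_trace {1..n} A (density_matrix {1..n} \<psi>)))
    = measure (distr (Pi\<^sub>M {1..n} (\<lambda>_. \<mu>)) ?Q ?g) ?S"
    unfolding rmps_def renyi2_entropy_eq[OF assms] by simp
  also have "\<dots> = measure (Pi\<^sub>M {1..n} (\<lambda>_. \<mu>)) (?g -` ?S \<inter> space (Pi\<^sub>M {1..n} (\<lambda>_. \<mu>)))"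
    by (rule measure_distr[OF g S])
  also have "?g -` ?S \<inter> space (Pi\<^sub>M {1..n} (\<lambda>_. \<mu>)) = {U\<in>space (Pi\<^sub>M {1..n} (\<lambda>_. \<mu>)).
      t \<le> - ln (Re (purity {1..n} A (mps e0 n U)) / (Re (norm_square {1..n} (mps e0 n U)))\<^sup>2)}"
    using measurable_space[OF g] by (auto simp: purity_restrict norm_square_restrict)
  finally show ?thesis .
qed

lemma norm_square_bound:
  assumes "U \<in> space (Pi\<^sub>M {1..n} (\<lambda>_. \<mu>))"
  shows "\<bar>Re (norm_square {1..n} (mps e0 n U))\<bar>
    \<le> (real CARD('b))\<^sup>2 * ((real CARD('b))\<^sup>2 * real CARD('d)) ^ n"
proof -
  have U: "U j \<in> space \<mu>" if "j \<in> set [1..<Suc n]" for j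
    using assms that by (auto simp: space_PiM)
  have "norm (norm_square {1..n} (mps e0 n U))
      \<le> (\<Sum>p::'b\<times>'b\<in>UNIV. norm (matprod (\<lambda>j. site1 e0 (U j)) [1..<Suc n] $ p $ p))"
    unfolding norm_square_mps trace_def by (rule norm_sum)
  also have "\<dots> \<le> (\<Sum>p::'b\<times>'b\<in>UNIV. (real CARD('b \<times> 'b) * real CARD('d)) ^ length [1..<Suc n])"
    using site1_norm[OF \<mu> d D U] by (intro sum_mono norm_matprod_le) auto
  also have "\<dots> = (real CARD('b))\<^sup>2 * ((real CARD('b))\<^sup>2 * real CARD('d)) ^ n"
    by (simp add: power2_eq_square del: upt_Suc)
  finally show ?thesis
    using abs_Re_le_cmod order_trans by blast
qed

end

theorem theorem2:
  fixes \<mu> :: "(complex^('d::finite \<times> 'b::finite)^('d \<times> 'b)) measure"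
    and e0 :: 'd
  assumes "CARD('d) \<ge> 2" and "CARD('b) \<ge> 2"
    and "haar_unitary \<mu>"
  shows "\<exists>c\<^sub>1>0. \<exists>c\<^sub>2>0. \<forall>n k :: nat. k \<ge> 2 \<longrightarrow> k dvd n \<longrightarrow>
    (let S = {1..n}; A = {j \<in> S. \<not> k dvd j} in
      \<P>(\<psi> in rmps \<mu> e0 n.
          renyi2_entropy A (partial_trace S A (density_matrix S \<psi>)) \<ge> c\<^sub>1 * (real n / real k))
        \<ge> 1 - exp (- c\<^sub>2 * (real n / real k)))"
proof -
  note hyps = assms(3,1,2)
  let ?d = "real CARD('d)" and ?D = "real CARD('b)"
  have dD: "?d \<ge> 2" "?D \<ge> 2"
    using assms(1,2) by simp_all
  define l where "l = gap ?d ?D"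
  have l: "0 < l" "l < 1"
    unfolding l_def using gap_pos[OF dD] gap_less_1[OF dD] by simp_all
  obtain q where q: "0 < q" "q < 1" and
    tr1: "\<And>k m. k \<ge> 2 \<Longrightarrow>
      trace (matprod (\<lambda>j. pair_transfer ?d ?D (\<not> k dvd j)) [1..<Suc (k * m)]) \<le> 2 * q ^ m" and
    tr2: "\<And>k m. k \<ge> 2 \<Longrightarrow> m > 0 \<Longrightarrow>
      trace (matprod (\<lambda>j. pair_transfer ?d ?D (\<not> k dvd j)) [1..<Suc (k * m)])
        \<le> 1 + l ^ (k * m) - (1 - q)\<^sup>2"
    unfolding l_def using pair_transfer_chain[OF dD] by blast
  define P where "P n = Pi\<^sub>M {1..n} (\<lambda>_. \<mu>)" for n :: nat
  define A where "A k n = {j \<in> {1..n}. \<not> k dvd j}" for k n :: nat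
  define N where "N n U = Re (norm_square {1..n} (mps e0 n U))"
    for n and U :: "nat \<Rightarrow> complex^('d \<times> 'b)^('d \<times> 'b)"
  define X where "X k n U = Re (purity {1..n} (A k n) (mps e0 n U))"
    for k n and U :: "nat \<Rightarrow> complex^('d \<times> 'b)^('d \<times> 'b)"
  define ent where "ent k n t = {U\<in>space (P n). t \<le> - ln (X k n U / (N n U)\<^sup>2)}" for k n t
  have prob_P: "prob_space (P n)" for n
    unfolding P_def by (intro prob_space_PiM prob_space_haar[OF hyps])
  have X_ge: "X k n U \<ge> 0" for k n U
    unfolding X_def by (rule Re_purity_nonneg) (auto simp: A_def)
  have X_pos: "X k n U > 0" if "N n U \<noteq> 0" for k n U
    unfolding X_def by (rule Re_purity_pos) (use that in \<open>auto simp: A_def N_def\<close>)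
  have sq: "(N n U)\<^sup>2 = Re (purity {1..n} {1..n} (mps e0 n U))"
    for n and U :: "nat \<Rightarrow> complex^('d \<times> 'b)^('d \<times> 'b)"
    unfolding N_def purity_all norm_square_eq by (simp del: of_real_sum of_real_power add: of_real_power[symmetric])
  have int_N: "integrable (P n) (N n)" and int_X: "integrable (P n) (X k n)"
    and int_sq: "integrable (P n) (\<lambda>U. (N n U)\<^sup>2)" for k n
    unfolding N_def[abs_def] X_def[abs_def] P_def sq[unfolded N_def]
    by (intro integrable_Re norm_square_integrable[OF hyps] purity_integrable[OF hyps])+
  have E_N: "(\<integral>U. N n U \<partial>P n) = 1" if "n > 0" for n
    unfolding N_def P_def
    using norm_square_expectation[OF hyps that] integral_Re[OF norm_square_integrable[OF hyps]] by simp
  have E_X: "(\<integral>U. X k n U \<partial>P n) = trace (matprod (\<lambda>j. pair_transfer ?d ?D (\<not> k dvd j)) [1..<Suc n])"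
    if "n > 0" for k n
  proof -
    have "matprod (\<lambda>j. pair_transfer ?d ?D (j \<in> A k n)) [1..<Suc n]
        = matprod (\<lambda>j. pair_transfer ?d ?D (\<not> k dvd j)) [1..<Suc n]"
      by (rule matprod_cong) (auto simp: A_def)
    then show ?thesis
      unfolding X_def P_def
      using purity_expectation[OF hyps that] integral_Re[OF purity_integrable[OF hyps]] by simp
  qed
  have E_sq: "(\<integral>U. (N n U)\<^sup>2 \<partial>P n) = 1 + l ^ n" if "n > 0" for n
  proof -
    have "matprod (\<lambda>j. pair_transfer ?d ?D (j \<in> {1..n})) [1..<Suc n]
        = matprod (\<lambda>_. pair_transfer ?d ?D True) [1..<Suc n]"
      by (rule matprod_cong) auto
    then show ?thesis
      unfolding sq P_def l_def
      using purity_expectation[OF hyps that, where A = "{1..n}"] integral_Re[OF purity_integrable[OF hyps]]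
        trace_pair_transfer_True[OF dD, of "[1..<Suc n]"] by (simp del: upt_Suc)
  qed

  \<comment> \<open>A lower bound, uniform in \<open>k\<close> and in \<open>m > 0\<close>, for the
    distance between the expectations of \<open>(N n U)\<^sup>2\<close> and
    \<open>X k n U\<close>.\<close>
  define \<epsilon> where "\<epsilon> = (1 - q)\<^sup>2"
  have \<epsilon>: "0 < \<epsilon>" "\<epsilon> < 1"
    using q by (simp_all add: \<epsilon>_def power_less_one_iff abs_square_less_1)
  have E_gap: "(\<integral>U. (N (k * m) U)\<^sup>2 \<partial>P (k * m)) - (\<integral>U. X k (k * m) U \<partial>P (k * m)) \<ge> \<epsilon>"
    if "k \<ge> 2" "m > 0" for k m
    using tr2[OF that] E_sq[of "k * m"] E_X[of "k * m"] that by (simp add: \<epsilon>_def)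

  \<comment> \<open>\<open>s\<close> dominates both decay rates: \<open>l\<close> of the variance
    and \<open>sqrt q\<close> of the purity after half of its decay is spent on
    \<open>exp t\<close>, whence \<open>a\<close> is half of \<open>- ln q\<close>. Likewise
    \<open>b\<close> keeps half of the decay of \<open>s\<close>, the other half absorbing a
    constant factor.\<close>
  define s where "s = max l (sqrt q)"
  have s: "0 < s" "s < 1"
    using l q by (auto simp: s_def)
  define a where "a = - ln q / 2"
  define b where "b = - ln s / 2"
  have ab: "a > 0" "b > 0"
    using q s by (simp_all add: a_def b_def)
  have exp_a: "exp a = 1 / sqrt q"
    using q by (simp add: a_def exp_minus ln_sqrt[symmetric] inverse_eq_divide flip: minus_divide_left)
  have exp_b: "exp (- b) * exp (- b) = s"
    using s by (simp add: b_def flip: exp_add)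
  \<comment> \<open>The constant 12 is the sum of the coefficients 4 and 8 of the two error terms;
    from \<open>m0\<close> on, \<open>exp (- b * m)\<close> outweighs it.\<close>
  obtain m0 :: nat where m0: "ln 12 / b < m0" "m0 > 0"
    by (metis reals_Archimedean2 gr0I of_nat_0 order_less_trans zero_less_Suc less_trans of_nat_less_iff lessI)
  have large: "measure (P (k * m)) (ent k (k * m) t) \<ge> 1 - exp (- b * m)"
    if k: "k \<ge> 2" and m: "m \<ge> m0" and t: "t \<le> a * m" for k m t
  proof -
    interpret prob_space "P (k * m)" by (rule prob_P)
    have "m > 0" using m m0 by simp
    then have n: "k * m > 0" using k by simp
    have "l ^ (k * m) \<le> l ^ m"
      using l k by (intro power_decreasing) auto
    also have "\<dots> \<le> s ^ m"
      using l by (intro power_mono) (auto simp: s_def)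
    finally have 1: "l ^ (k * m) \<le> s ^ m" .
    have "q ^ m * exp t \<le> q ^ m * exp (a * m)"
      using t q by simp
    also have "\<dots> = (q * exp a) ^ m"
      by (simp add: power_mult_distrib exp_of_nat2_mult)
    also have "q * exp a = sqrt q"
      using q by (simp add: exp_a real_div_sqrt)
    also have "sqrt q ^ m \<le> s ^ m"
      using q by (intro power_mono) (auto simp: s_def)
    finally have 2: "q ^ m * exp t \<le> s ^ m" .
    have "12 = exp (ln (12 :: real))" by simp
    also have "\<dots> \<le> exp (b * m)"
      using m0 m ab by (simp add: field_simps del: exp_ln)
        (meson less_imp_le mult_left_mono of_nat_le_iff order_trans)
    finally have "12 * exp (- b * m) \<le> 1"
      by (simp add: exp_minus field_simps)
    then have "12 * exp (- b * m) * exp (- b * m) \<le> 1 * exp (- b * m)"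
      by (intro mult_right_mono) auto
    moreover have "s ^ m = exp (- b * m) * exp (- b * m)"
      unfolding exp_b[symmetric] power_mult_distrib exp_of_nat2_mult ..
    ultimately have 3: "12 * s ^ m \<le> exp (- b * m)"
      by (simp add: mult.assoc)
    have "1 - (4 * l ^ (k * m) + 4 * (2 * q ^ m) * exp t) \<le> prob (ent k (k * m) t)"
      unfolding ent_def using n tr1[OF k, of m] X_ge X_pos
      by (intro entropy_tail_concentrated int_N int_X int_sq) (auto simp: E_N E_sq E_X)
    then show ?thesis
      using 1 2 3 by simp
  qed

  \<comment> \<open>From \<open>n0\<close> on the variance \<open>l ^ n\<close> is at most
    \<epsilon> / 8, so \<open>2 * (N n U - 1)\<^sup>2\<close> can serve as \<open>Y\<close> in
    \<open>entropy_tail_gap\<close>.\<close>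
  obtain n0 :: nat where n0: "l ^ n0 \<le> \<epsilon> / 8"
    using real_arch_pow_inv[of "\<epsilon> / 8" l] \<epsilon> l by (auto intro: less_imp_le)
  \<comment> \<open>One constant for both cases: the square bounds \<open>(N n U)\<^sup>2\<close>
    outright for \<open>n < n0\<close>, where \<open>Y\<close> is zero, and the 2 goes with the
    choice of \<open>Y\<close> for \<open>n \<ge> n0\<close>.\<close>
  define C where "C = (?D\<^sup>2 * (?D\<^sup>2 * ?d) ^ n0)\<^sup>2 + 2"
  have small: "measure (P (k * m)) (ent k (k * m) t) \<ge> \<epsilon> / (4 * C)"
    if k: "k \<ge> 2" and m: "m > 0" and t: "t \<le> - ln (1 - \<epsilon> / 4)" for k m t
  proof -
    define n where "n = k * m"
    have n: "n > 0" using k m by (simp add: n_def)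
    interpret prob_space "P n" by (rule prob_P)
    have "l ^ n \<le> 1"
      using l by (simp add: power_le_one)
    then have sq2: "expectation (\<lambda>U. (N n U)\<^sup>2) \<le> 2"
      using E_sq[OF n] by simp
    note tail = entropy_tail_gap[OF int_N int_sq int_X _ E_gap[OF k m, folded n_def] \<epsilon> sq2 X_ge X_pos _ _ _ _ t]
    have "\<epsilon> / (4 * C) \<le> prob {U \<in> space (P n). t \<le> - ln (X k n U / (N n U)\<^sup>2)}"
    proof (cases "n \<ge> n0")
      case True
      have e: "(\<lambda>U. 2 * (N n U - 1)\<^sup>2) = (\<lambda>U. 2 * (N n U)\<^sup>2 - 4 * N n U + 2)"
        by (simp add: power2_diff algebra_simps)
      have int: "integrable (P n) (\<lambda>U. 2 * (N n U - 1)\<^sup>2)"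
        unfolding e using int_N int_sq by simp
      have "l ^ n \<le> l ^ n0"
        using l True by (intro power_decreasing) auto
      moreover have "expectation (\<lambda>U. 2 * (N n U - 1)\<^sup>2) = 2 * l ^ n"
        unfolding e using int_N int_sq E_N[OF n] E_sq[OF n] by (simp add: prob_space)
      ultimately have "expectation (\<lambda>U. 2 * (N n U - 1)\<^sup>2) \<le> \<epsilon> / 4"
        using n0 by simp
      moreover have "(N n U)\<^sup>2 \<le> 2 * (N n U - 1)\<^sup>2 + C" for U
      proof -
        have "0 \<le> (N n U - 2)\<^sup>2" by simp
        then have "(N n U)\<^sup>2 \<le> 2 * (N n U - 1)\<^sup>2 + 2"
          by (simp add: power2_diff)
        then show ?thesis by (simp add: C_def add_nonneg_nonneg le_add_same_cancel1 order_trans)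
      qed
      ultimately show ?thesis
        by (intro tail[OF int]) (auto simp: C_def add_nonneg_pos)
    next
      case False
      have "(N n U)\<^sup>2 \<le> 0 + C" if "U \<in> space (P n)" for U
      proof -
        have "1 * 1 \<le> ?D\<^sup>2 * ?d"
          using dD by (intro mult_mono) (auto simp: one_le_power)
        then have "(?D\<^sup>2 * ?d) ^ n \<le> (?D\<^sup>2 * ?d) ^ n0"
          using False by (intro power_increasing) auto
        then have "?D\<^sup>2 * (?D\<^sup>2 * ?d) ^ n \<le> ?D\<^sup>2 * (?D\<^sup>2 * ?d) ^ n0"
          by (intro mult_left_mono) auto
        with norm_square_bound[OF hyps] that have "\<bar>N n U\<bar> \<le> ?D\<^sup>2 * (?D\<^sup>2 * ?d) ^ n0"
          unfolding N_def P_def by (meson order_trans)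
        then have "\<bar>N n U\<bar>\<^sup>2 \<le> (?D\<^sup>2 * (?D\<^sup>2 * ?d) ^ n0)\<^sup>2"
          by (intro power_mono) auto
        then show ?thesis by (simp add: C_def)
      qed
      then show ?thesis
        using \<epsilon> by (intro tail[OF integrable_zero]) (auto simp: C_def add_nonneg_pos)
    qed
    then show ?thesis
      by (simp add: ent_def n_def)
  qed

  define \<kappa> where "\<kappa> = \<epsilon> / (4 * C)"
  have C: "C \<ge> 2"
    by (simp add: C_def)
  have \<kappa>: "0 < \<kappa>" "\<kappa> < 1"
    using \<epsilon> C by (auto simp: \<kappa>_def divide_less_eq)
  \<comment> \<open>For \<open>m < m0\<close> the minima keep \<open>c1 * m\<close> and
    \<open>c2 * m\<close> below the fixed thresholds of the bounded case; for
    \<open>m \<ge> m0\<close> they are at most \<open>a\<close> and \<open>b\<close>.\<close>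
  define c1 where "c1 = min a (- ln (1 - \<epsilon> / 4) / m0)"
  define c2 where "c2 = min b (- ln (1 - \<kappa>) / m0)"
  have c: "c1 > 0" "c2 > 0"
    using ab \<epsilon> \<kappa> m0 by (auto simp: c1_def c2_def field_simps)
  have main: "measure (P (k * m)) (ent k (k * m) (c1 * m)) \<ge> 1 - exp (- c2 * m)" if k: "k \<ge> 2" for k m
  proof -
    \<comment> \<open>For \<open>m = 0\<close> the claimed lower bound is
      \<open>1 - exp 0 = 0\<close>.\<close>
    consider "m = 0" | "m \<ge> m0" | "0 < m" "m < m0" by linarith
    then show ?thesis
    proof cases
      case 2
      have "1 - exp (- c2 * m) \<le> 1 - exp (- b * m)"
        by (simp add: c2_def mult_right_mono)
      also have "\<dots> \<le> measure (P (k * m)) (ent k (k * m) (c1 * m))"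
        by (rule large[OF k 2]) (simp add: c1_def mult_right_mono)
      finally show ?thesis .
    next
      case 3
      have le: "min x (y / m0) * m \<le> y" if "y \<ge> 0" for x y :: real
      proof -
        have "min x (y / m0) * m \<le> y / m0 * m"
          by (intro mult_right_mono) auto
        also have "\<dots> \<le> y / m0 * m0"
          using 3 that by (intro mult_left_mono) auto
        finally show ?thesis using 3 by simp
      qed
      have "c2 * m \<le> - ln (1 - \<kappa>)"
        unfolding c2_def using \<kappa> by (intro le) simp
      then have "exp (ln (1 - \<kappa>)) \<le> exp (- c2 * m)"
        by simp
      moreover have "exp (ln (1 - \<kappa>)) = 1 - \<kappa>"
        using \<kappa> by (intro exp_ln) simp
      ultimately have "1 - exp (- c2 * m) \<le> \<kappa>"
        by linarith
      also have "\<kappa> = \<epsilon> / (4 * C)"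
        by (rule \<kappa>_def)
      also have "\<dots> \<le> measure (P (k * m)) (ent k (k * m) (c1 * m))"
        by (rule small[OF k 3(1)]) (unfold c1_def, use \<epsilon> in \<open>intro le, simp\<close>)
      finally show ?thesis .
    qed simp
  qed
  show ?thesis
  proof (intro exI conjI allI impI)
    show "c1 > 0" "c2 > 0" by (rule c)+
    fix n k :: nat assume k: "k \<ge> 2" and "k dvd n"
    then obtain m where m: "n = k * m" by blast
    have "real n / real k = m"
      using k by (simp add: m)
    moreover have "A k n \<subseteq> {1..n}"
      by (auto simp: A_def)
    ultimately show "let S = {1..n}; A = {j \<in> S. \<not> k dvd j} in
      \<P>(\<psi> in rmps \<mu> e0 n.
          renyi2_entropy A (partial_trace S A (density_matrix S \<psi>)) \<ge> c1 * (real n / real k))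
        \<ge> 1 - exp (- c2 * (real n / real k))"
      using main[OF k, of m] rmps_entropy_prob[OF hyps, of "A k n" n e0 "c1 * m"]
      unfolding Let_def by (simp add: ent_def P_def X_def N_def A_def m)
  qed
qed

end
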